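(* Let $M\subseteq\mathbb{R}[x,y]=\mathbb{R}[x_1,\dots,x_n,y_1,\dots,y_n]$ be a hermitian module with the Quillen property (Q): $M$ contains every $f\in\mathbb{R}[x,y]$ with $f>0$ on $X_M$. Then $M$ has the subnormality property (S): every tuple $T=(T_1,\dots,T_n)$ of pairwise commuting bounded operators on a Hilbert space satisfying $p(T,T^* )\ge0$ for every $p\in M$ is subnormal.
   Context: $\mathbb{C}[z,\bar z]$ is the polynomial ring in $2n$ independent variables $z=(z_1,\dots,z_n)$, $\bar z=(\bar z_1,\dots,\bar z_n)$, with the conjugate-linear ring involution $*$ determined by $z_j^*=\bar z_j$. Its fixed ring is $\mathbb{R}[x,y]$, where $x_j=\frac12(z_j+\bar z_j)$, $y_j=\frac1{2i}(z_j-\bar z_j)$. For $f\in\mathbb{R}[x,y]$ and $a\in\mathbb{C}^n$, $f(a)\in\mathbb{R}$ is the value obtained by substituting $a$ for $z$ and $\bar a$ for $\bar z$. $\Sigma_h$ is the convex cone in $\mathbb{R}[x,y]$ generated by $\{pp^*: p\in\mathbb{C}[z]\}$. A hermitian module is a subset $M\subseteq\mathbb{R}[x,y]$ with $1\in M$, $M+M\subseteq M$ and $\Sigma_hM\subseteq M$. $X_M=\{a\in\mathbb{C}^n: g(a)\ge0\ \forall g\in M\}$. Hilbert spaces are complex and separable. Hereditary calculus: for a commuting tuple $T$ of bounded operators and $f=\sum_{\alpha,\beta}a_{\alpha,\beta}z^\alpha\bar z^\beta$, $f(T,T^* )=\sum_{\alpha,\beta}a_{\alpha,\beta}T^{*\beta}T^\alpha$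 (all adjoints to the left). A commuting tuple $T$ on $E$ is subnormal if there are a Hilbert space $E'\supseteq E$ and a tuple $(T_1',\dots,T_n')$ of pairwise commuting bounded normal operators on $E'$ that leave $E$ invariant and satisfy $T_i'|_E=T_i$ for all $i$. *)

theory Defs
  imports "HOL-Analysis.Analysis" "HOL-Library.Poly_Mapping" "HOL-Library.Function_Algebras"
begin

section \<open>The polynomial ring C[z, zbar] with its involution\<close>

text \<open>The variables are indexed by the finite type \<open>'n\<close>. A monomial is a pair of exponent vectors,
  and the coefficient of \<open>z\<^sup>\<alpha> zbar\<^sup>\<beta>\<close> in \<open>f\<close> is \<open>Poly_Mapping.lookup f (\<alpha>, \<beta>)\<close>. The ring operations
  are those of the monoid ring provided by \<^theory>\<open>HOL-Library.Poly_Mapping\<close>.\<close>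

type_synonym 'n mon = "('n \<Rightarrow>\<^sub>0 nat) \<times> ('n \<Rightarrow>\<^sub>0 nat)"
type_synonym 'n cpoly = "'n mon \<Rightarrow>\<^sub>0 complex"

definition zvar :: "'n \<Rightarrow> 'n cpoly"
  where "zvar j = Poly_Mapping.single (Poly_Mapping.single j 1, 0) 1"

definition zbar :: "'n \<Rightarrow> 'n cpoly"
  where "zbar j = Poly_Mapping.single (0, Poly_Mapping.single j 1) 1"

definition const_poly :: "complex \<Rightarrow> 'n cpoly"
  where "const_poly c = Poly_Mapping.single 0 c"

definition star :: "'n cpoly \<Rightarrow> 'n cpoly"
  where "star f = Poly_Mapping.map cnj (Poly_Mapping.map_key prod.swap f)"

lemma lookup_star: "Poly_Mapping.lookup (star f) (\<alpha>, \<beta>) = cnj (Poly_Mapping.lookup f (\<beta>, \<alpha>))"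
  by (auto simp: star_def map.rep_eq map_key.rep_eq when_def)

lemma lookup_star': "Poly_Mapping.lookup (star f) m = cnj (Poly_Mapping.lookup f (prod.swap m))"
  by (cases m) (simp add: lookup_star)

lemma star_add: "star (f + g) = star f + star g"
  by (rule poly_mapping_eqI) (simp add: lookup_star' lookup_add)

lemma star_single: "star (Poly_Mapping.single m c) = Poly_Mapping.single (prod.swap m) (cnj c)"
proof (rule poly_mapping_eqI)
  fix k
  have "m = prod.swap k \<longleftrightarrow> prod.swap m = k" by auto
  then show "Poly_Mapping.lookup (star (Poly_Mapping.single m c)) k =
      Poly_Mapping.lookup (Poly_Mapping.single (prod.swap m) (cnj c)) k"
    by (simp add: lookup_star' lookup_single when_def)
qed

lemma star_star: "star (star f) = f"
  by (rule poly_mapping_eqI) (simp add: lookup_star')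

lemma star_const_poly: "star (const_poly c) = const_poly (cnj c)"
  by (simp add: const_poly_def star_single zero_prod_def)

lemma star_zvar: "star (zvar j) = zbar j"
  by (simp add: zvar_def zbar_def star_single)

lemma keys_star: "Poly_Mapping.keys (star f) = prod.swap ` Poly_Mapping.keys f"
proof (rule set_eqI)
  fix m :: "'a mon"
  have "m \<in> prod.swap ` A \<longleftrightarrow> prod.swap m \<in> A" for A
    by (metis (no_types) image_eqI imageE swap_swap)
  then show "m \<in> Poly_Mapping.keys (star f) \<longleftrightarrow> m \<in> prod.swap ` Poly_Mapping.keys f"
    by (simp add: in_keys_iff lookup_star')
qed

lemma star_zero: "star 0 = 0"
  by (rule poly_mapping_eqI) (simp add: lookup_star')

lemma cpoly_induct:
  assumes "P 0" "\<And>m c. P (Poly_Mapping.single m c)" "\<And>f g. P f \<Longrightarrow> P g \<Longrightarrow> P (f + g)"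
  shows "P (f :: 'n cpoly)"
proof (induction f rule: update_induct)
  case const
  show ?case by (rule assms(1))
next
  case (update f a b)
  have "Poly_Mapping.update a b f = f + Poly_Mapping.single a b"
    using update by (intro poly_mapping_eqI)
      (auto simp: lookup_update lookup_add lookup_single in_keys_iff when_def)
  with update assms show ?case by auto
qed

lemma star_mult: "star (f * g) = star f * star g"
proof (induction f rule: cpoly_induct)
  case 1
  show ?case by (simp add: star_zero)
next
  case (2 m c)
  show ?case
  proof (induction g rule: cpoly_induct)
    case (2 k d)
    have "prod.swap (m + k) = prod.swap m + prod.swap k"
      by (cases m; cases k) simp
    then show ?case by (simp only: star_single mult_single complex_cnj_mult)
  qed (simp_all add: star_zero star_add distrib_left)
next
  case (3 f1 f2)
  then show ?case by (simp add: distrib_right star_add)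
qed

text \<open>\<open>\<real>[x,y]\<close> is the fixed ring of the involution.\<close>

definition real_polys :: "'n cpoly set"
  where "real_polys = {f. star f = f}"

text \<open>\<open>\<complex>[z]\<close>, as a subring of \<open>\<complex>[z, zbar]\<close>.\<close>

definition hol_polys :: "'n cpoly set"
  where "hol_polys = {p. \<forall>(\<alpha>, \<beta>) \<in> Poly_Mapping.keys p. \<beta> = 0}"

definition evaluate :: "'n::finite cpoly \<Rightarrow> complex ^ 'n \<Rightarrow> complex"
  where "evaluate f a = (\<Sum>(\<alpha>, \<beta>) \<in> Poly_Mapping.keys f. Poly_Mapping.lookup f (\<alpha>, \<beta>) *
    (\<Prod>j\<in>UNIV. (a $ j) ^ Poly_Mapping.lookup \<alpha> j) * (\<Prod>j\<in>UNIV. cnj (a $ j) ^ Poly_Mapping.lookup \<beta> j))"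

lemma evaluate_star: "evaluate (star f) a = cnj (evaluate f a)"
  unfolding evaluate_def keys_star
  by (subst sum.reindex)
    (auto simp: inj_on_def cnj_sum cnj_prod lookup_star intro!: sum.cong)

text \<open>The following only discards an imaginary part that is zero on \<^const>\<open>real_polys\<close>, by the lemma
  after it.\<close>

definition value_at :: "'n::finite cpoly \<Rightarrow> complex ^ 'n \<Rightarrow> real"
  where "value_at f a = Re (evaluate f a)"

lemma evaluate_real_polys: "f \<in> real_polys \<Longrightarrow> evaluate f a = complex_of_real (value_at f a)"
  using evaluate_star[of f a] by (simp add: real_polys_def value_at_def complex_eq_iff)


section \<open>Hermitian modules\<close>

text \<open>The convex cone \<open>\<Sigma>\<^sub>h\<close> generated by the \<open>p p\<^sup>*\<close> with \<open>p \<in> \<complex>[z]\<close>.\<close>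

inductive_set Sigma_h :: "'n cpoly set" where
  square: "p \<in> hol_polys \<Longrightarrow> p * star p \<in> Sigma_h"
| add: "s \<in> Sigma_h \<Longrightarrow> t \<in> Sigma_h \<Longrightarrow> s + t \<in> Sigma_h"
| scale: "s \<in> Sigma_h \<Longrightarrow> 0 \<le> c \<Longrightarrow> const_poly (complex_of_real c) * s \<in> Sigma_h"

definition hermitian_module :: "'n cpoly set \<Rightarrow> bool"
  where "hermitian_module M \<longleftrightarrow> M \<subseteq> real_polys \<and> 1 \<in> M \<and>
    (\<forall>f\<in>M. \<forall>g\<in>M. f + g \<in> M) \<and> (\<forall>s\<in>Sigma_h. \<forall>f\<in>M. s * f \<in> M)"

definition nonneg_set :: "'n::finite cpoly set \<Rightarrow> (complex ^ 'n) set"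
  where "nonneg_set M = {a. \<forall>g\<in>M. 0 \<le> value_at g a}"

definition quillen_property :: "'n::finite cpoly set \<Rightarrow> bool"
  where "quillen_property M \<longleftrightarrow>
    (\<forall>f\<in>real_polys. (\<forall>a\<in>nonneg_set M. 0 < value_at f a) \<longrightarrow> f \<in> M)"


section \<open>Separable complex Hilbert spaces\<close>

text \<open>A Hilbert space is given by a linear subspace of an ambient complex vector space \<open>'v\<close> (no
  topology on \<open>'v\<close>; the subspace may be everything) and an inner product on that subspace, linear in
  the first argument. Values of the inner product outside the subspace are irrelevant.\<close>

record 'v hilb =
  hset :: "'v set"
  hscale :: "complex \<Rightarrow> 'v \<Rightarrow> 'v"
  hinner :: "'v \<Rightarrow> 'v \<Rightarrow> complex"

definition hnorm :: "'v hilb \<Rightarrow> 'v \<Rightarrow> real"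
  where "hnorm E x = sqrt (Re (hinner E x x))"

definition hilbert_space :: "'v::ab_group_add hilb \<Rightarrow> bool"
  where "hilbert_space E \<longleftrightarrow>
    vector_space (hscale E) \<and> module.subspace (hscale E) (hset E) \<and>
    \<comment> \<open>inner product\<close>
    (\<forall>x\<in>hset E. \<forall>y\<in>hset E. \<forall>z\<in>hset E. hinner E (x + y) z = hinner E x z + hinner E y z) \<and>
    (\<forall>c. \<forall>x\<in>hset E. \<forall>y\<in>hset E. hinner E (hscale E c x) y = c * hinner E x y) \<and>
    (\<forall>x\<in>hset E. \<forall>y\<in>hset E. hinner E y x = cnj (hinner E x y)) \<and>
    (\<forall>x\<in>hset E. x \<noteq> 0 \<longrightarrow> 0 < Re (hinner E x x)) \<and>
    \<comment> \<open>completeness\<close>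
    (\<forall>X :: nat \<Rightarrow> 'v. range X \<subseteq> hset E \<longrightarrow>
      (\<forall>e>0. \<exists>N. \<forall>m\<ge>N. \<forall>n\<ge>N. hnorm E (X m - X n) < e) \<longrightarrow>
      (\<exists>x\<in>hset E. (\<lambda>n. hnorm E (X n - x)) \<longlonglongrightarrow> 0)) \<and>
    \<comment> \<open>separability\<close>
    (\<exists>D \<subseteq> hset E. countable D \<and> (\<forall>x\<in>hset E. \<forall>e>0. \<exists>d\<in>D. hnorm E (x - d) < e))"

definition linear_map :: "'v::ab_group_add hilb \<Rightarrow> 'w::ab_group_add hilb \<Rightarrow> ('v \<Rightarrow> 'w) \<Rightarrow> bool"
  where "linear_map E F J \<longleftrightarrow> J ` hset E \<subseteq> hset F \<and>
    (\<forall>x\<in>hset E. \<forall>y\<in>hset E. J (x + y) = J x + J y) \<and>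
    (\<forall>c. \<forall>x\<in>hset E. J (hscale E c x) = hscale F c (J x))"

definition isometric_embedding :: "'v::ab_group_add hilb \<Rightarrow> 'w::ab_group_add hilb \<Rightarrow> ('v \<Rightarrow> 'w) \<Rightarrow> bool"
  where "isometric_embedding E F J \<longleftrightarrow> linear_map E F J \<and>
    (\<forall>x\<in>hset E. \<forall>y\<in>hset E. hinner F (J x) (J y) = hinner E x y)"

definition bounded_operator :: "'v::ab_group_add hilb \<Rightarrow> ('v \<Rightarrow> 'v) \<Rightarrow> bool"
  where "bounded_operator E T \<longleftrightarrow> linear_map E E T \<and>
    (\<exists>K. \<forall>x\<in>hset E. hnorm E (T x) \<le> K * hnorm E x)"

text \<open>The adjoint of a bounded operator; outside \<open>hset E\<close> its values are irrelevant.\<close>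

definition adj :: "'v hilb \<Rightarrow> ('v \<Rightarrow> 'v) \<Rightarrow> 'v \<Rightarrow> 'v"
  where "adj E T y = (THE w. w \<in> hset E \<and> (\<forall>x\<in>hset E. hinner E (T x) y = hinner E x w))"

definition normal_operator :: "'v::ab_group_add hilb \<Rightarrow> ('v \<Rightarrow> 'v) \<Rightarrow> bool"
  where "normal_operator E T \<longleftrightarrow> bounded_operator E T \<and>
    (\<forall>x\<in>hset E. T (adj E T x) = adj E T (T x))"

definition positive_operator :: "'v hilb \<Rightarrow> ('v \<Rightarrow> 'v) \<Rightarrow> bool"
  where "positive_operator E A \<longleftrightarrow> (\<forall>x\<in>hset E. hinner E (A x) x \<in> \<real>\<^sub>\<ge>\<^sub>0)"

definition commuting :: "'v hilb \<Rightarrow> ('n \<Rightarrow> 'v \<Rightarrow> 'v) \<Rightarrow> bool"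
  where "commuting E T \<longleftrightarrow> (\<forall>i j. \<forall>x\<in>hset E. T i (T j x) = T j (T i x))"


section \<open>Hereditary calculus and subnormality\<close>

text \<open>\<open>T\<^sup>\<alpha>\<close>, the composition of the powers \<open>T\<^sub>j ^^ \<alpha>\<^sub>j\<close> taken in some enumeration of the index type;
  on \<open>hset E\<close> it does not depend on the enumeration when \<open>T\<close> is a commuting tuple.\<close>

definition enumeration :: "'n::finite list"
  where "enumeration = (SOME js. distinct js \<and> set js = UNIV)"

definition multipower :: "('n::finite \<Rightarrow> 'v \<Rightarrow> 'v) \<Rightarrow> ('n \<Rightarrow>\<^sub>0 nat) \<Rightarrow> 'v \<Rightarrow> 'v"
  where "multipower T \<alpha> = foldr (\<lambda>j g. (T j ^^ Poly_Mapping.lookup \<alpha> j) \<circ> g) enumeration id"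

definition hereditary ::
    "'v::ab_group_add hilb \<Rightarrow> ('n::finite \<Rightarrow> 'v \<Rightarrow> 'v) \<Rightarrow> 'n cpoly \<Rightarrow> 'v \<Rightarrow> 'v"
  where "hereditary E T f x = (\<Sum>(\<alpha>, \<beta>) \<in> Poly_Mapping.keys f.
    hscale E (Poly_Mapping.lookup f (\<alpha>, \<beta>)) (multipower (\<lambda>j. adj E (T j)) \<beta> (multipower T \<alpha> x)))"

text \<open>HOL cannot quantify existentially over types, so the space \<open>F\<close> carrying the normal extension is
  taken inside the vector space \<open>\<complex>\<^sup>\<nat>\<close>, with an arbitrary inner product. Up to isometric isomorphism
  this covers all separable Hilbert spaces (\<open>\<ell>\<^sup>2\<close> and the \<open>\<complex>\<^sup>d\<close> are subspaces of \<open>\<complex>\<^sup>\<nat>\<close>).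
  The inclusion of \<open>E\<close> into \<open>F\<close> is accordingly an isometric embedding \<open>J\<close>.\<close>

definition subnormal :: "'v::ab_group_add hilb \<Rightarrow> ('n \<Rightarrow> 'v \<Rightarrow> 'v) \<Rightarrow> bool"
  where "subnormal E T \<longleftrightarrow>
    (\<exists>(F :: (nat \<Rightarrow> complex) hilb) J T'.
      hilbert_space F \<and> isometric_embedding E F J \<and>
      (\<forall>j. normal_operator F (T' j)) \<and> commuting F T' \<and>
      (\<forall>j. T' j ` J ` hset E \<subseteq> J ` hset E) \<and>
      (\<forall>j. \<forall>x\<in>hset E. T' j (J x) = J (T j x)))"

text \<open>The type argument is the ambient vector space of the Hilbert spaces considered; the property is
  meant for all \<open>'v\<close>.\<close>

definition subnormality_property :: "'v::ab_group_add itself \<Rightarrow> 'n::finite cpoly set \<Rightarrow> bool"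
  where "subnormality_property _ M \<longleftrightarrow>
    (\<forall>(E :: 'v hilb) T.
      hilbert_space E \<and> (\<forall>j. bounded_operator E (T j)) \<and> commuting E T \<and>
      (\<forall>p\<in>M. positive_operator E (hereditary E T p)) \<longrightarrow> subnormal E T)"

end

theory Submission
  imports Defs
begin

text \<open>By (Q), every \<open>q q\<^sup>* + \<epsilon>\<close> with \<open>q \<in> \<complex>[z, zbar]\<close> lies in \<open>M\<close>, so each functional
  \<open>f \<mapsto> \<langle>f(T, T\<^sup>*) x, x\<rangle>\<close> is nonnegative on all squares \<open>q q\<^sup>*\<close>. Together with the geometric growth
  of its moments this gives nonnegativity on products of factors \<open>\<rho> \<plusminus> s\<close> with \<open>s\<close> a real or imaginary
  part of a variable, in particular on Bernstein basis polynomials of a cube. These form partitions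
  of unity, and approximating by them (a map that is positive on a commutative algebra is completely
  positive) upgrades positivity to the Bram-Halmos condition
  \<open>\<Sum>\<^sub>p\<^sub>,\<^sub>q \<langle>(f\<^sub>p f\<^sub>q\<^sup>*)(T, T\<^sup>*) x\<^sub>p, x\<^sub>q\<rangle> \<ge> 0\<close> for all finite families of \<open>f\<^sub>p\<close> and \<open>x\<^sub>p\<close>.
  The completion of this form carries the normal extension: multiplication by \<open>z\<^sub>j\<close>, with adjoint
  multiplication by \<open>zbar\<^sub>j\<close>.\<close>

section \<open>Completion of a positive semidefinite form\<close>

text \<open>For \<open>q\<close> in C[z] the number \<open>L x x (q * star q)\<close> is the squared
  norm of \<open>q(T) x\<close>, so the information in (Q) lies in those \<open>q\<close> that
  involve zbar. Two obstacles shape the proof. The hereditary calculus is not multiplicative: the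
  operator of \<open>\<rho> - s\<close> is positive by the norm bounds on \<open>T\<close>, but this
  does not carry over to products of \<open>\<rho> - s\<close> with squares, so those are treated
  through the moments of one vector. Moreover (Q) controls one vector paired with itself, while a
  normal extension needs positivity for polynomials attached to several independent vectors. Weights
  bridge the gap: once every variable is replaced by a number, a finite family collapses to a single
  vector, a combination of the \<open>x_p\<close>, and the one-vector inequality applies. The
  weights are required to stay positive against every square, so that further factors can be
  multiplied in.\<close>

locale psd_form =
  fixes V :: "'a set" and add :: "'a \<Rightarrow> 'a \<Rightarrow> 'a" and scl :: "complex \<Rightarrow> 'a \<Rightarrow> 'a"
    and B :: "'a \<Rightarrow> 'a \<Rightarrow> complex"
  assumes add_closed [simp]: "x \<in> V \<Longrightarrow> y \<in> V \<Longrightarrow> add x y \<in> V"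
    and scl_closed [simp]: "x \<in> V \<Longrightarrow> scl c x \<in> V"
    and form_add_left: "x \<in> V \<Longrightarrow> y \<in> V \<Longrightarrow> z \<in> V \<Longrightarrow> B (add x y) z = B x z + B y z"
    and form_scl_left: "x \<in> V \<Longrightarrow> y \<in> V \<Longrightarrow> B (scl c x) y = c * B x y"
    and form_sym: "x \<in> V \<Longrightarrow> y \<in> V \<Longrightarrow> B y x = cnj (B x y)"
    and form_nonneg: "x \<in> V \<Longrightarrow> 0 \<le> Re (B x x)"
begin

definition nrm :: "'a \<Rightarrow> real"
  where "nrm x = sqrt (Re (B x x))"

text \<open>No vector space laws are assumed of \<open>add\<close> and \<open>scl\<close>. For lists
  under append, \<open>diff x x\<close> is not a neutral element but merely has norm zero, so
  identities between vectors are replaced by identities between the values of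
  \<open>B\<close>.\<close>

definition diff :: "'a \<Rightarrow> 'a \<Rightarrow> 'a"
  where "diff x y = add x (scl (-1) y)"

lemma diff_closed [simp]: "x \<in> V \<Longrightarrow> y \<in> V \<Longrightarrow> diff x y \<in> V"
  by (simp add: diff_def)

lemma form_add_right: "x \<in> V \<Longrightarrow> y \<in> V \<Longrightarrow> z \<in> V \<Longrightarrow> B x (add y z) = B x y + B x z"
  by (metis add_closed complex_cnj_add form_add_left form_sym)

lemma form_scl_right: "x \<in> V \<Longrightarrow> y \<in> V \<Longrightarrow> B x (scl c y) = cnj c * B x y"
  by (metis scl_closed complex_cnj_mult form_scl_left form_sym)

lemma form_diff_left: "x \<in> V \<Longrightarrow> y \<in> V \<Longrightarrow> z \<in> V \<Longrightarrow> B (diff x y) z = B x z - B y z"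
  by (simp add: diff_def form_add_left form_scl_left)

lemma form_diff_right: "x \<in> V \<Longrightarrow> y \<in> V \<Longrightarrow> z \<in> V \<Longrightarrow> B x (diff y z) = B x y - B x z"
  by (simp add: diff_def form_add_right form_scl_right)

lemma nrm_nonneg: "x \<in> V \<Longrightarrow> 0 \<le> nrm x"
  by (simp add: nrm_def form_nonneg)

lemma nrm_square: "x \<in> V \<Longrightarrow> (nrm x)\<^sup>2 = Re (B x x)"
  by (simp add: nrm_def form_nonneg)

lemma form_self: "x \<in> V \<Longrightarrow> B x x = complex_of_real ((nrm x)\<^sup>2)"
  by (metis Reals_cnj_iff complex_is_Real_iff form_sym nrm_square of_real_Re)

lemma Cauchy_Schwarz_square:
  assumes x: "x \<in> V" and y: "y \<in> V"
  shows "(cmod (B x y))\<^sup>2 \<le> Re (B x x) * Re (B y y)"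
proof -
  define b where "b = B x y"
  define \<beta> where "\<beta> = Re (B y y)"
  have \<beta>: "0 \<le> \<beta>" by (simp add: \<beta>_def form_nonneg y)
  have *: "0 \<le> Re (B x x) - 2 * s * (cmod b)\<^sup>2 + s\<^sup>2 * (cmod b)\<^sup>2 * \<beta>" for s :: real
  proof -
    \<comment> \<open>A real multiple of \<open>b\<close> makes both cross terms real multiples of
      \<open>(cmod b)\<^sup>2\<close>, leaving a real quadratic in \<open>s\<close>.\<close>
    define c where "c = - complex_of_real s * b"
    have yx: "B y x = cnj b" using form_sym[OF x y] by (simp add: b_def)
    have yy: "B y y = complex_of_real \<beta>"
      using form_self[OF y] nrm_square[OF y] by (simp add: \<beta>_def)
    have "B (add x (scl c y)) (add x (scl c y)) =
        B x x + cnj c * b + c * cnj b + c * cnj c * complex_of_real \<beta>"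
      using x y by (simp add: form_add_left form_add_right form_scl_left form_scl_right yx yy
          flip: b_def) (simp add: algebra_simps)
    moreover have "cnj c * b = complex_of_real (- s * (cmod b)\<^sup>2)"
      unfolding c_def by (simp add: mult.commute[of "cnj b"] mult.assoc flip: complex_norm_square)
    moreover have "c * cnj b = complex_of_real (- s * (cmod b)\<^sup>2)"
      unfolding c_def by (simp add: mult.assoc flip: complex_norm_square)
    moreover have "c * cnj c = complex_of_real (s\<^sup>2 * (cmod b)\<^sup>2)"
      unfolding complex_norm_square[symmetric] c_def
      by (simp add: norm_mult power_mult_distrib)
    ultimately have "B (add x (scl c y)) (add x (scl c y)) =
        B x x + complex_of_real (- 2 * s * (cmod b)\<^sup>2 + s\<^sup>2 * (cmod b)\<^sup>2 * \<beta>)"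
      by simp
    with form_nonneg[of "add x (scl c y)"] x y show ?thesis by simp
  qed
  show ?thesis
  proof (cases "\<beta> = 0")
    case True
    have "b = 0"
    proof (rule ccontr)
      assume "b \<noteq> 0"
      then have "(cmod b)\<^sup>2 > 0" by simp
      \<comment> \<open>For \<beta> = 0 the quadratic is affine in \<open>s\<close>, and this
        \<open>s\<close> gives it the value -1.\<close>
      with *[of "(Re (B x x) + 1) / (2 * (cmod b)\<^sup>2)"] True show False by simp
    qed
    then show ?thesis by (simp add: b_def[symmetric] \<beta>_def[symmetric] True)
  next
    case False
    with \<beta> have "\<beta> > 0" by simp
    \<comment> \<open>The minimum of the quadratic is at \<open>s = 1 / \<beta>\<close>.\<close>
    with *[of "1 / \<beta>"] have "0 \<le> Re (B x x) - (cmod b)\<^sup>2 / \<beta>"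
      by (simp add: power2_eq_square)
    with \<open>\<beta> > 0\<close> show ?thesis
      by (simp add: b_def[symmetric] \<beta>_def[symmetric] divide_le_eq)
  qed
qed

lemma Cauchy_Schwarz:
  assumes "x \<in> V" "y \<in> V"
  shows "cmod (B x y) \<le> nrm x * nrm y"
  using real_sqrt_le_mono[OF Cauchy_Schwarz_square[OF assms]]
  by (simp add: nrm_def real_sqrt_mult)

lemma nrm_scl: "x \<in> V \<Longrightarrow> nrm (scl c x) = cmod c * nrm x"
proof -
  assume x: "x \<in> V"
  have "B (scl c x) (scl c x) = complex_of_real ((cmod c)\<^sup>2) * B x x"
    using x by (simp add: form_scl_left form_scl_right complex_norm_square del: of_real_power)
  then show ?thesis
    by (simp add: nrm_def real_sqrt_mult del: of_real_power)
qed

lemma nrm_triangle: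
  assumes x: "x \<in> V" and y: "y \<in> V"
  shows "nrm (add x y) \<le> nrm x + nrm y"
proof (rule power2_le_imp_le)
  have "Re (B x y) \<le> nrm x * nrm y"
    using complex_Re_le_cmod[of "B x y"] Cauchy_Schwarz[OF x y] by linarith
  moreover have "Re (B y x) = Re (B x y)" using form_sym[OF x y] by simp
  ultimately show "(nrm (add x y))\<^sup>2 \<le> (nrm x + nrm y)\<^sup>2"
    using x y by (simp add: power2_sum nrm_square form_add_left form_add_right)
qed (simp add: nrm_nonneg x y)

lemma nrm_diff_commute: "x \<in> V \<Longrightarrow> y \<in> V \<Longrightarrow> nrm (diff x y) = nrm (diff y x)"
  by (simp add: nrm_def form_diff_left form_diff_right)

lemma nrm_diff_triangle:
  assumes "x \<in> V" "y \<in> V" "z \<in> V"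
  shows "nrm (diff x z) \<le> nrm (diff x y) + nrm (diff y z)"
proof -
  have "B (diff x z) (diff x z) = B (add (diff x y) (diff y z)) (add (diff x y) (diff y z))"
    using assms by (simp add: form_diff_left form_diff_right form_add_left form_add_right)
  then have "nrm (diff x z) = nrm (add (diff x y) (diff y z))" by (simp add: nrm_def)
  then show ?thesis using assms nrm_triangle[of "diff x y" "diff y z"] by simp
qed

lemma nrm_diff_add:
  assumes "x \<in> V" "y \<in> V" "x' \<in> V" "y' \<in> V"
  shows "nrm (diff (add x y) (add x' y')) \<le> nrm (diff x x') + nrm (diff y y')"
proof -
  let ?u = "diff (add x y) (add x' y')" and ?w = "add (diff x x') (diff y y')"
  have "B ?u ?u = B ?w ?w"
    using assms by (simp add: form_diff_left form_diff_right form_add_left form_add_right)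
  then have "nrm ?u = nrm ?w" by (simp add: nrm_def)
  then show ?thesis using assms nrm_triangle[of "diff x x'" "diff y y'"] by simp
qed

lemma nrm_diff_scl:
  assumes "x \<in> V" "y \<in> V"
  shows "nrm (diff (scl c x) (scl c y)) = cmod c * nrm (diff x y)"
proof -
  let ?u = "diff (scl c x) (scl c y)" and ?w = "scl c (diff x y)"
  have "B ?u ?u = B ?w ?w"
    using assms
    by (simp add: form_diff_left form_diff_right form_scl_left form_scl_right algebra_simps)
  then have "nrm ?u = nrm ?w" by (simp add: nrm_def)
  then show ?thesis using assms by (simp add: nrm_scl)
qed

lemma nrm_le_add_diff:
  assumes "x \<in> V" "y \<in> V"
  shows "nrm x \<le> nrm y + nrm (diff x y)"
proof -
  have "B x x = B (add y (diff x y)) (add y (diff x y))"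
    using assms by (simp add: form_diff_left form_diff_right form_add_left form_add_right)
  then have "nrm x = nrm (add y (diff x y))" by (simp add: nrm_def)
  then show ?thesis using assms nrm_triangle[of y "diff x y"] by simp
qed

definition Cau :: "(nat \<Rightarrow> 'a) \<Rightarrow> bool"
  where "Cau v \<longleftrightarrow> range v \<subseteq> V \<and> (\<forall>e>0. \<exists>N. \<forall>i\<ge>N. \<forall>j\<ge>N. nrm (diff (v i) (v j)) < e)"

lemma Cau_in: "Cau v \<Longrightarrow> v k \<in> V"
  by (auto simp: Cau_def)

lemma Cau_bounded:
  assumes v: "Cau v"
  obtains C where "C > 0" "\<And>k. nrm (v k) \<le> C"
proof -
  obtain N where N: "\<And>i j. i \<ge> N \<Longrightarrow> j \<ge> N \<Longrightarrow> nrm (diff (v i) (v j)) < 1"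
    using v unfolding Cau_def by (meson zero_less_one)
  have vV: "v k \<in> V" for k using v by (rule Cau_in)
  define C where "C = 1 + nrm (v N) + (\<Sum>k<N. nrm (v k))"
  have "nrm (v k) \<le> C" for k
  proof (cases "k < N")
    case True
    then have "nrm (v k) \<le> (\<Sum>k<N. nrm (v k))"
      by (intro member_le_sum) (auto simp: nrm_nonneg vV)
    then show ?thesis using nrm_nonneg[OF vV[of N]] by (simp add: C_def)
  next
    case False
    then have "nrm (v k) \<le> nrm (v N) + 1"
      using nrm_le_add_diff[OF vV[of k] vV[of N]] N[of k N] by simp
    then show ?thesis
      using sum_nonneg[of "{..<N}" "\<lambda>k. nrm (v k)"] by (simp add: C_def nrm_nonneg vV)
  qed
  moreover have "C > 0"
    unfolding C_def by (intro add_pos_nonneg sum_nonneg nrm_nonneg vV) simp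
  ultimately show ?thesis using that by blast
qed

lemma Cau_const: "x \<in> V \<Longrightarrow> Cau (\<lambda>_. x)"
  by (auto simp: Cau_def nrm_def form_diff_left form_diff_right)

lemma Cau_add:
  assumes v: "Cau v" and w: "Cau w"
  shows "Cau (\<lambda>k. add (v k) (w k))"
  unfolding Cau_def
proof (intro conjI allI impI)
  show "range (\<lambda>k. add (v k) (w k)) \<subseteq> V" using Cau_in[OF v] Cau_in[OF w] by auto
  fix e :: real assume e: "e > 0"
  obtain N1 where N1: "\<And>i j. i \<ge> N1 \<Longrightarrow> j \<ge> N1 \<Longrightarrow> nrm (diff (v i) (v j)) < e / 2"
    using v e unfolding Cau_def by (meson half_gt_zero)
  obtain N2 where N2: "\<And>i j. i \<ge> N2 \<Longrightarrow> j \<ge> N2 \<Longrightarrow> nrm (diff (w i) (w j)) < e / 2"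
    using w e unfolding Cau_def by (meson half_gt_zero)
  show "\<exists>N. \<forall>i\<ge>N. \<forall>j\<ge>N. nrm (diff (add (v i) (w i)) (add (v j) (w j))) < e"
  proof (intro exI[of _ "max N1 N2"] allI impI)
    fix i j assume "max N1 N2 \<le> i" "max N1 N2 \<le> j"
    with N1[of i j] N2[of i j] nrm_diff_add[of "v i" "w i" "v j" "w j"]
      Cau_in[OF v] Cau_in[OF w]
    show "nrm (diff (add (v i) (w i)) (add (v j) (w j))) < e" by simp
  qed
qed

lemma Cau_image:
  assumes v: "Cau v" and f: "f ` V \<subseteq> V"
    and le: "\<And>x y. x \<in> V \<Longrightarrow> y \<in> V \<Longrightarrow> nrm (diff (f x) (f y)) \<le> C * nrm (diff x y)"
  shows "Cau (\<lambda>k. f (v k))"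
  unfolding Cau_def
proof (intro conjI allI impI)
  show "range (\<lambda>k. f (v k)) \<subseteq> V" using f Cau_in[OF v] by auto
  fix e :: real assume e: "e > 0"
  define D where "D = max C 1"
  have D: "D > 0" "C \<le> D" by (auto simp: D_def)
  obtain N where N: "\<And>i j. i \<ge> N \<Longrightarrow> j \<ge> N \<Longrightarrow> nrm (diff (v i) (v j)) < e / D"
    using v e D unfolding Cau_def by (meson divide_pos_pos)
  show "\<exists>N. \<forall>i\<ge>N. \<forall>j\<ge>N. nrm (diff (f (v i)) (f (v j))) < e"
  proof (intro exI[of _ N] allI impI)
    fix i j assume "N \<le> i" "N \<le> j"
    then have "D * nrm (diff (v i) (v j)) < e"
      using N[of i j] D by (simp add: pos_less_divide_eq mult.commute)
    moreover have "C * nrm (diff (v i) (v j)) \<le> D * nrm (diff (v i) (v j))"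
      using D Cau_in[OF v] by (intro mult_right_mono nrm_nonneg) auto
    ultimately show "nrm (diff (f (v i)) (f (v j))) < e"
      using le[of "v i" "v j"] Cau_in[OF v] by force
  qed
qed

lemma Cau_scl: "Cau v \<Longrightarrow> Cau (\<lambda>k. scl c (v k))"
  by (rule Cau_image[of _ _ "cmod c"]) (auto simp: nrm_diff_scl)

lemma Cau_diff: "Cau v \<Longrightarrow> Cau w \<Longrightarrow> Cau (\<lambda>k. diff (v k) (w k))"
  unfolding diff_def by (intro Cau_add Cau_scl)

lemma Cau_form_convergent:
  assumes v: "Cau v" and w: "Cau w"
  shows "convergent (\<lambda>k. B (v k) (w k))"
proof -
  note [simp] = Cau_in[OF v] Cau_in[OF w]
  obtain C where C: "C > 0" "\<And>k. nrm (v k) \<le> C" using Cau_bounded[OF v] by blast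
  obtain D where D: "D > 0" "\<And>k. nrm (w k) \<le> D" using Cau_bounded[OF w] by blast
  have "Cauchy (\<lambda>k. B (v k) (w k))"
  proof (rule CauchyI)
    fix e :: real assume e: "e > 0"
    obtain N1 where N1: "\<And>i j. i \<ge> N1 \<Longrightarrow> j \<ge> N1 \<Longrightarrow> nrm (diff (v i) (v j)) < e / (2 * D)"
      using v e D(1) unfolding Cau_def by (meson divide_pos_pos mult_pos_pos zero_less_numeral)
    obtain N2 where N2: "\<And>i j. i \<ge> N2 \<Longrightarrow> j \<ge> N2 \<Longrightarrow> nrm (diff (w i) (w j)) < e / (2 * C)"
      using w e C(1) unfolding Cau_def by (meson divide_pos_pos mult_pos_pos zero_less_numeral)
    show "\<exists>M. \<forall>m\<ge>M. \<forall>n\<ge>M. norm (B (v m) (w m) - B (v n) (w n)) < e"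
    proof (intro exI[of _ "max N1 N2"] allI impI)
      fix i j assume ij: "max N1 N2 \<le> i" "max N1 N2 \<le> j"
      have eq: "B (v i) (w i) - B (v j) (w j) =
          B (diff (v i) (v j)) (w i) + B (v j) (diff (w i) (w j))"
        by (simp add: form_diff_left form_diff_right)
      have "cmod (B (v i) (w i) - B (v j) (w j)) \<le>
          nrm (diff (v i) (v j)) * nrm (w i) + nrm (v j) * nrm (diff (w i) (w j))"
        unfolding eq
        using Cauchy_Schwarz[of "diff (v i) (v j)" "w i"] Cauchy_Schwarz[of "v j" "diff (w i) (w j)"]
        by (intro norm_triangle_le) simp
      also have "\<dots> \<le> nrm (diff (v i) (v j)) * D + C * nrm (diff (w i) (w j))"
      proof (rule add_mono)
        show "nrm (diff (v i) (v j)) * nrm (w i) \<le> nrm (diff (v i) (v j)) * D"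
          by (rule mult_left_mono[OF D(2)]) (simp add: nrm_nonneg)
        show "nrm (v j) * nrm (diff (w i) (w j)) \<le> C * nrm (diff (w i) (w j))"
          by (rule mult_right_mono[OF C(2)]) (simp add: nrm_nonneg)
      qed
      also have "\<dots> < e"
      proof -
        have "nrm (diff (v i) (v j)) * D < e / 2"
          using N1[of i j] ij D(1) by (simp add: field_simps)
        moreover have "C * nrm (diff (w i) (w j)) < e / 2"
          using N2[of i j] ij C(1) by (simp add: field_simps)
        ultimately show ?thesis by simp
      qed
      finally show "norm (B (v i) (w i) - B (v j) (w j)) < e" .
    qed
  qed
  then show ?thesis by (rule Cauchy_convergent)
qed

end

section \<open>Completion of a separable form inside the space of sequences\<close>

locale dense_psd_form = psd_form +
  fixes d :: "nat \<Rightarrow> 'a"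
  assumes d_in [simp]: "d n \<in> V"
    and dense: "x \<in> V \<Longrightarrow> 0 < e \<Longrightarrow> \<exists>n. nrm (diff x (d n)) < e"
begin

text \<open>Since \<open>v\<close> is bounded, pairings with the dense sequence suffice:
  \<open>w k\<close> is close to \<open>w N\<close>, which is close to some \<open>d n\<close>, and
  each of the three resulting terms is below \<open>e / 3\<close>. This is what makes the inner
  product of two points independent of the sequences representing them.\<close>

lemma weakly_null:
  assumes v: "Cau v" and w: "Cau w" and null: "\<And>n. (\<lambda>k. B (v k) (d n)) \<longlonglongrightarrow> 0"
  shows "(\<lambda>k. B (v k) (w k)) \<longlonglongrightarrow> 0"
proof (rule LIMSEQ_I)
  note [simp] = Cau_in[OF v] Cau_in[OF w]
  fix e :: real assume e: "e > 0"
  obtain C where C: "C > 0" "\<And>k. nrm (v k) \<le> C" using Cau_bounded[OF v] by blast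
  define \<delta> where "\<delta> = e / (3 * C)"
  have \<delta>: "\<delta> > 0" using e C by (simp add: \<delta>_def)
  obtain N where N: "\<And>i j. i \<ge> N \<Longrightarrow> j \<ge> N \<Longrightarrow> nrm (diff (w i) (w j)) < \<delta>"
    using w \<delta> unfolding Cau_def by meson
  obtain n where n: "nrm (diff (w N) (d n)) < \<delta>" using dense[of "w N" \<delta>] \<delta> by auto
  obtain M where M: "\<And>k. k \<ge> M \<Longrightarrow> cmod (B (v k) (d n)) < e / 3"
    using LIMSEQ_D[OF null[of n], of "e / 3"] e by auto
  show "\<exists>no. \<forall>k\<ge>no. norm (B (v k) (w k) - 0) < e"
  proof (intro exI[of _ "max M N"] allI impI)
    fix k assume k: "max M N \<le> k"
    have bound: "cmod (B (v k) u) < e / 3" if "u \<in> V" "nrm u < \<delta>" for u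
    proof -
      have "cmod (B (v k) u) \<le> nrm (v k) * nrm u" using that by (simp add: Cauchy_Schwarz)
      also have "\<dots> \<le> C * nrm u" using C that by (intro mult_right_mono) (auto simp: nrm_nonneg)
      also have "\<dots> < C * \<delta>" using that C by simp
      finally show ?thesis using C by (simp add: \<delta>_def)
    qed
    have eq: "B (v k) (w k) =
        B (v k) (diff (w k) (w N)) + B (v k) (diff (w N) (d n)) + B (v k) (d n)"
      by (simp add: form_diff_right)
    have "cmod (B (v k) (w k)) \<le> cmod (B (v k) (diff (w k) (w N))) + cmod (B (v k) (diff (w N) (d n))) +
        cmod (B (v k) (d n))"
      unfolding eq by (intro norm_triangle_le add_mono order_refl norm_triangle_ineq)
    also have "\<dots> < e / 3 + e / 3 + e / 3"
      using k M[of k] bound N[of k N] n by (intro add_strict_mono) auto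
    finally show "norm (B (v k) (w k) - 0) < e" by simp
  qed
qed

text \<open>A point of the completion is the sequence of its inner products with the dense sequence \<open>d\<close>.
  This places the completion inside \<open>\<complex>\<^sup>\<nat>\<close>, and an operator whose formal adjoint maps the
  values of \<open>d\<close> to values of \<open>d\<close> extends to it by composition with a map of indices.\<close>

definition rep :: "(nat \<Rightarrow> complex) \<Rightarrow> (nat \<Rightarrow> 'a) \<Rightarrow> bool"
  where "rep \<phi> v \<longleftrightarrow> Cau v \<and> (\<forall>n. (\<lambda>k. B (v k) (d n)) \<longlonglongrightarrow> \<phi> n)"

definition ip :: "(nat \<Rightarrow> complex) \<Rightarrow> (nat \<Rightarrow> complex) \<Rightarrow> complex"
  where "ip \<phi> \<psi> = lim (\<lambda>k. B ((SOME v. rep \<phi> v) k) ((SOME v. rep \<psi> v) k))"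

definition hat :: "'a \<Rightarrow> nat \<Rightarrow> complex"
  where "hat x = (\<lambda>n. B x (d n))"

definition completion :: "(nat \<Rightarrow> complex) hilb"
  where "completion = \<lparr>hset = {\<phi>. \<exists>v. rep \<phi> v}, hscale = (\<lambda>c \<phi> n. c * \<phi> n), hinner = ip\<rparr>"

lemma completion_simps [simp]:
  "hset completion = {\<phi>. \<exists>v. rep \<phi> v}"
  "hscale completion = (\<lambda>c \<phi> n. c * \<phi> n)"
  "hinner completion = ip"
  by (simp_all add: completion_def)

lemma rep_unique_lim:
  assumes "rep \<phi> v" "rep \<phi> v'" "Cau w" "(\<lambda>k. B (v k) (w k)) \<longlonglongrightarrow> l"
  shows "(\<lambda>k. B (v' k) (w k)) \<longlonglongrightarrow> l"
proof -
  have c: "Cau v" "Cau v'" using assms by (auto simp: rep_def)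
  note [simp] = Cau_in[OF c(1)] Cau_in[OF c(2)] Cau_in[OF assms(3)]
  have "(\<lambda>k. B (diff (v k) (v' k)) (d n)) \<longlonglongrightarrow> 0" for n
    using tendsto_diff[of "\<lambda>k. B (v k) (d n)" "\<phi> n" sequentially "\<lambda>k. B (v' k) (d n)" "\<phi> n"] assms
    by (simp add: rep_def form_diff_left)
  then have "(\<lambda>k. B (diff (v k) (v' k)) (w k)) \<longlonglongrightarrow> 0"
    by (rule weakly_null[OF Cau_diff[OF c] assms(3)])
  from tendsto_diff[OF assms(4) this] show ?thesis by (simp add: form_diff_left)
qed

lemma ip_lim:
  assumes v: "rep \<phi> v" and w: "rep \<psi> w"
  shows "(\<lambda>k. B (v k) (w k)) \<longlonglongrightarrow> ip \<phi> \<psi>"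
proof -
  define v' where "v' = (SOME v. rep \<phi> v)"
  define w' where "w' = (SOME w. rep \<psi> w)"
  have v': "rep \<phi> v'" unfolding v'_def by (rule someI[of "rep \<phi>", OF v])
  have w': "rep \<psi> w'" unfolding w'_def by (rule someI[of "rep \<psi>", OF w])
  have c: "Cau v" "Cau v'" "Cau w" "Cau w'" using v w v' w' by (auto simp: rep_def)
  have "(\<lambda>k. B (v' k) (w' k)) \<longlonglongrightarrow> ip \<phi> \<psi>"
    using Cau_form_convergent[OF c(2,4)] unfolding ip_def v'_def w'_def convergent_LIMSEQ_iff .
  then have "(\<lambda>k. B (v k) (w' k)) \<longlonglongrightarrow> ip \<phi> \<psi>"
    using rep_unique_lim[OF v' v c(4)] by blast
  \<comment> \<open>\<open>rep_unique_lim\<close> exchanges only the first argument; conjugation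
    brings the second one into that position.\<close>
  then have "(\<lambda>k. B (w' k) (v k)) \<longlonglongrightarrow> cnj (ip \<phi> \<psi>)"
    using form_sym[OF Cau_in[OF c(1)] Cau_in[OF c(4)]] by (simp add: lim_cnj)
  then have "(\<lambda>k. B (w k) (v k)) \<longlonglongrightarrow> cnj (ip \<phi> \<psi>)"
    using rep_unique_lim[OF w' w c(1)] by blast
  then have "(\<lambda>k. cnj (B (w k) (v k))) \<longlonglongrightarrow> cnj (cnj (ip \<phi> \<psi>))"
    by (subst lim_cnj)
  then show ?thesis
    using form_sym[OF Cau_in[OF c(3)] Cau_in[OF c(1)]] by simp
qed

lemma rep_add: "rep \<phi> v \<Longrightarrow> rep \<psi> w \<Longrightarrow> rep (\<phi> + \<psi>) (\<lambda>k. add (v k) (w k))"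
  by (auto simp: rep_def Cau_in form_add_left intro!: Cau_add tendsto_add)

lemma rep_scl: "rep \<phi> v \<Longrightarrow> rep (\<lambda>n. c * \<phi> n) (\<lambda>k. scl c (v k))"
  by (auto simp: rep_def Cau_in form_scl_left intro!: Cau_scl tendsto_mult)

lemma rep_diff: "rep \<phi> v \<Longrightarrow> rep \<psi> w \<Longrightarrow> rep (\<phi> - \<psi>) (\<lambda>k. diff (v k) (w k))"
  by (auto simp: rep_def Cau_in form_diff_left intro!: Cau_diff tendsto_diff)

lemma rep_hat: "x \<in> V \<Longrightarrow> rep (hat x) (\<lambda>_. x)"
  by (auto simp: rep_def hat_def intro!: Cau_const)

lemma ip_hat: "x \<in> V \<Longrightarrow> y \<in> V \<Longrightarrow> ip (hat x) (hat y) = B x y"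
  using ip_lim[OF rep_hat rep_hat] LIMSEQ_unique[OF _ tendsto_const] by blast

text \<open>Each law passes to the limit along representing sequences. Through the sublocale that
  follows, the norm estimates proved for \<open>B\<close> become available in the
  completion.\<close>

lemma psd_form_completion: "psd_form {\<phi>. \<exists>v. rep \<phi> v} plus (\<lambda>c \<phi> n. c * \<phi> n) ip"
proof (unfold_locales, goal_cases)
  case (1 \<phi> \<psi>) then show ?case by (auto intro: rep_add)
next
  case (2 \<phi> c) then show ?case by (auto intro: rep_scl)
next
  case (3 \<phi> \<psi> \<omega>)
  then obtain u v w where r: "rep \<phi> u" "rep \<psi> v" "rep \<omega> w" by auto
  then have "\<And>k. u k \<in> V \<and> v k \<in> V \<and> w k \<in> V" by (auto simp: rep_def Cau_in)
  then have "(\<lambda>k. B (add (u k) (v k)) (w k)) \<longlonglongrightarrow> ip \<phi> \<omega> + ip \<psi> \<omega>"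
    using tendsto_add[OF ip_lim[OF r(1,3)] ip_lim[OF r(2,3)]] by (simp add: form_add_left)
  with ip_lim[OF rep_add[OF r(1,2)] r(3)] show ?case by (rule LIMSEQ_unique)
next
  case (4 \<phi> \<psi> c)
  then obtain u v where r: "rep \<phi> u" "rep \<psi> v" by auto
  then have "\<And>k. u k \<in> V \<and> v k \<in> V" by (auto simp: rep_def Cau_in)
  then have "(\<lambda>k. B (scl c (u k)) (v k)) \<longlonglongrightarrow> c * ip \<phi> \<psi>"
    using tendsto_mult[OF tendsto_const ip_lim[OF r]] by (simp add: form_scl_left)
  with ip_lim[OF rep_scl[OF r(1)] r(2)] show ?case by (rule LIMSEQ_unique)
next
  case (5 \<phi> \<psi>)
  then obtain u v where r: "rep \<phi> u" "rep \<psi> v" by auto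
  then have "u k \<in> V" "v k \<in> V" for k by (auto simp: rep_def Cau_in)
  then have eq: "B (v k) (u k) = cnj (B (u k) (v k))" for k by (rule form_sym)
  have "(\<lambda>k. cnj (B (u k) (v k))) \<longlonglongrightarrow> cnj (ip \<phi> \<psi>)"
    using ip_lim[OF r] by (subst lim_cnj)
  with ip_lim[OF r(2,1)] show ?case unfolding eq by (rule LIMSEQ_unique)
next
  case (6 \<phi>)
  then obtain u where r: "rep \<phi> u" by auto
  then have "u k \<in> V" for k by (auto simp: rep_def Cau_in)
  then show ?case
    using tendsto_Re[OF ip_lim[OF r r]] by (intro LIMSEQ_le_const) (auto simp: form_nonneg)
qed

sublocale F: psd_form "{\<phi>. \<exists>v. rep \<phi> v}" plus "\<lambda>c \<phi> n. c * \<phi> n" ip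
  by (rule psd_form_completion)

lemma F_nrm: "F.nrm = hnorm completion"
  by (simp add: fun_eq_iff F.nrm_def hnorm_def)

lemma F_diff: "F.diff \<phi> \<psi> = \<phi> - \<psi>"
  by (simp add: F.diff_def fun_eq_iff)

lemma nrm_lim: "rep \<phi> v \<Longrightarrow> (\<lambda>k. nrm (v k)) \<longlonglongrightarrow> F.nrm \<phi>"
  unfolding nrm_def F.nrm_def by (intro tendsto_real_sqrt tendsto_Re ip_lim)

lemma F_nrm_hat: "x \<in> V \<Longrightarrow> F.nrm (hat x) = nrm x"
  by (simp add: F.nrm_def nrm_def ip_hat)

lemma hat_in: "x \<in> V \<Longrightarrow> \<exists>v. rep (hat x) v"
  using rep_hat by blast

lemma hat_diff: "x \<in> V \<Longrightarrow> y \<in> V \<Longrightarrow> hat (diff x y) = hat x - hat y"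
  by (simp add: hat_def fun_eq_iff form_diff_left)

lemma hat_scl: "x \<in> V \<Longrightarrow> hat (scl c x) = (\<lambda>n. c * hat x n)"
  by (simp add: hat_def form_scl_left)

text \<open>The norm of \<open>\<phi> - hat (v k)\<close> is the limit over \<open>i\<close> of
  \<open>nrm (diff (v i) (v k))\<close>, which is small on a Cauchy tail. Thus the images of
  elements of \<open>V\<close> are dense; the bound \<open>e / 2\<close> compensates for the
  strictness lost in the limit.\<close>

lemma rep_approx:
  assumes r: "rep \<phi> v" and e: "e > 0"
  obtains N where "\<And>k. k \<ge> N \<Longrightarrow> F.nrm (\<phi> - hat (v k)) < e"
proof -
  have c: "Cau v" using r by (simp add: rep_def)
  note [simp] = Cau_in[OF c]
  obtain N where N: "\<And>i j. i \<ge> N \<Longrightarrow> j \<ge> N \<Longrightarrow> nrm (diff (v i) (v j)) < e / 2"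
    using c e unfolding Cau_def by (meson half_gt_zero)
  have "F.nrm (\<phi> - hat (v k)) < e" if k: "k \<ge> N" for k
  proof -
    have "(\<lambda>i. nrm (diff (v i) (v k))) \<longlonglongrightarrow> F.nrm (\<phi> - hat (v k))"
      by (rule nrm_lim[OF rep_diff[OF r rep_hat]]) simp
    then have "F.nrm (\<phi> - hat (v k)) \<le> e / 2"
      using N k less_imp_le by (intro LIMSEQ_le_const2) blast+
    then show ?thesis using e by simp
  qed
  then show ?thesis using that by blast
qed

text \<open>If the norms of \<open>v k\<close> tend to zero, so do all pairings with
  \<open>d\<close>, by Cauchy-Schwarz. Recording a point by its pairings therefore sends null
  vectors to the zero sequence and takes the place of a quotient.\<close>

lemma F_definite:
  assumes r: "rep \<phi> v" and 0: "Re (ip \<phi> \<phi>) = 0"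
  shows "\<phi> = 0"
proof
  fix n
  have c: "Cau v" using r by (simp add: rep_def)
  have "(\<lambda>k. nrm (v k) * nrm (d n)) \<longlonglongrightarrow> 0"
    using tendsto_mult_left_zero[of "\<lambda>k. nrm (v k)"] nrm_lim[OF r] 0 by (simp add: F.nrm_def)
  then have "(\<lambda>k. B (v k) (d n)) \<longlonglongrightarrow> 0"
    by (rule Lim_null_comparison[rotated]) (simp add: Cauchy_Schwarz Cau_in[OF c])
  moreover have "(\<lambda>k. B (v k) (d n)) \<longlonglongrightarrow> \<phi> n" using r by (simp add: rep_def)
  ultimately show "\<phi> n = 0 n" using LIMSEQ_unique by fastforce
qed

text \<open>Each \<open>X m\<close> is replaced by an element \<open>w m\<close> of \<open>V\<close>
  at distance less than \<open>1 / (m + 1)\<close>. The sequence \<open>w\<close> is Cauchy for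
  \<open>B\<close>, hence represents a point, and this point is the limit.\<close>

lemma F_complete:
  assumes X: "F.Cau X"
  shows "\<exists>\<phi>. (\<exists>v. rep \<phi> v) \<and> (\<lambda>n. F.nrm (X n - \<phi>)) \<longlonglongrightarrow> 0"
proof -
  have Xin: "\<exists>v. rep (X m) v" for m using F.Cau_in[OF X] by simp
  have "\<exists>x\<in>V. F.nrm (X m - hat x) < 1 / real (Suc m)" for m
  proof -
    obtain v where v: "rep (X m) v" using Xin by blast
    obtain N where "\<And>k. k \<ge> N \<Longrightarrow> F.nrm (X m - hat (v k)) < 1 / real (Suc m)"
      by (rule rep_approx[OF v, of "1 / real (Suc m)"]) auto
    then show ?thesis using v by (intro bexI[of _ "v N"]) (auto simp: rep_def Cau_in)
  qed
  then obtain w where w: "\<And>m. w m \<in> V" "\<And>m. F.nrm (X m - hat (w m)) < 1 / real (Suc m)"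
    by metis
  note [simp] = w(1) hat_in Xin
  have null: "(\<lambda>m. F.nrm (X m - hat (w m))) \<longlonglongrightarrow> 0"
    using w(2) F.nrm_nonneg[of "X _ - hat (w _)"] F.diff_closed[of "X _" "hat (w _)"]
    by (intro tendsto_sandwich[OF _ _ tendsto_const LIMSEQ_inverse_real_of_nat])
      (auto simp: F_diff inverse_eq_divide less_imp_le intro!: always_eventually)
  have "Cau w"
    unfolding Cau_def
  proof (intro conjI allI impI)
    show "range w \<subseteq> V" by auto
    fix e :: real assume e: "e > 0"
    obtain N where N: "\<And>i j. i \<ge> N \<Longrightarrow> j \<ge> N \<Longrightarrow> F.nrm (X i - X j) < e / 3"
      using X e unfolding F.Cau_def F_diff by (meson divide_pos_pos zero_less_numeral)
    obtain M where M: "\<And>m. m \<ge> M \<Longrightarrow> F.nrm (X m - hat (w m)) < e / 3"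
      using order_tendstoD(2)[OF null, of "e / 3"] e unfolding eventually_sequentially
      by (meson divide_pos_pos zero_less_numeral)
    show "\<exists>N. \<forall>i\<ge>N. \<forall>j\<ge>N. nrm (diff (w i) (w j)) < e"
    proof (intro exI[of _ "max M N"] allI impI)
      fix i j assume ij: "max M N \<le> i" "max M N \<le> j"
      have "nrm (diff (w i) (w j)) = F.nrm (hat (w i) - hat (w j))"
        by (simp add: F_nrm_hat flip: hat_diff)
      also have "\<dots> \<le> F.nrm (hat (w i) - X i) + F.nrm (X i - hat (w j))"
        using F.nrm_diff_triangle[of "hat (w i)" "X i" "hat (w j)"] by (simp add: F_diff)
      also have "\<dots> \<le> F.nrm (X i - hat (w i)) + (F.nrm (X i - X j) + F.nrm (X j - hat (w j)))"
        using F.nrm_diff_triangle[of "X i" "X j" "hat (w j)"]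
          F.nrm_diff_commute[of "hat (w i)" "X i"] by (simp add: F_diff)
      finally show "nrm (diff (w i) (w j)) < e"
        using M[of i] M[of j] N[of i j] ij by simp
    qed
  qed
  then have "\<exists>l. (\<lambda>k. B (w k) (d n)) \<longlonglongrightarrow> l" for n
    using Cau_form_convergent[OF _ Cau_const[OF d_in]] by (auto simp: convergent_def)
  then obtain \<phi> where "\<And>n. (\<lambda>k. B (w k) (d n)) \<longlonglongrightarrow> \<phi> n" by metis
  with \<open>Cau w\<close> have r: "rep \<phi> w" by (simp add: rep_def)
  have "(\<lambda>m. F.nrm (X m - \<phi>)) \<longlonglongrightarrow> 0"
  proof (rule LIMSEQ_I)
    fix e :: real assume e: "e > 0"
    obtain N where N: "\<And>k. k \<ge> N \<Longrightarrow> F.nrm (\<phi> - hat (w k)) < e / 2"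
      by (rule rep_approx[OF r, of "e / 2"]) (use e in auto)
    obtain M where M: "\<And>m. m \<ge> M \<Longrightarrow> F.nrm (X m - hat (w m)) < e / 2"
      using order_tendstoD(2)[OF null, of "e / 2"] e unfolding eventually_sequentially
      by (meson half_gt_zero)
    show "\<exists>no. \<forall>n\<ge>no. norm (F.nrm (X n - \<phi>) - 0) < e"
    proof (intro exI[of _ "max M N"] allI impI)
      fix n assume n: "max M N \<le> n"
      have ph: "\<exists>v. rep \<phi> v" using r by blast
      have "F.nrm (X n - \<phi>) \<le> F.nrm (X n - hat (w n)) + F.nrm (\<phi> - hat (w n))"
        using F.nrm_diff_triangle[of "X n" "hat (w n)" \<phi>] F.nrm_diff_commute[of "hat (w n)" \<phi>] ph
        by (simp add: F_diff)
      moreover have "0 \<le> F.nrm (X n - \<phi>)"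
        using F.nrm_nonneg[of "X n - \<phi>"] F.diff_closed[of "X n" \<phi>] ph by (simp add: F_diff)
      ultimately show "norm (F.nrm (X n - \<phi>) - 0) < e" using N[of n] M[of n] n by simp
    qed
  qed
  with r show ?thesis by blast
qed

lemma hilbert_space_completion: "hilbert_space completion"
proof -
  have vs: "vector_space (\<lambda>c (\<phi> :: nat \<Rightarrow> complex) n. c * \<phi> n)"
    by unfold_locales (auto simp: fun_eq_iff algebra_simps)
  \<comment> \<open>\<open>V\<close> has no designated zero; \<open>scl 0 (d 0)\<close> serves as a
    null vector.\<close>
  have "rep 0 (\<lambda>k. scl 0 (d 0))"
    using rep_scl[OF rep_hat[OF d_in], of 0 0] by (simp add: zero_fun_def)
  then have sub: "module.subspace (\<lambda>c \<phi> n. c * \<phi> n) {\<phi>. \<exists>v. rep \<phi> v}"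
    using vs by (auto simp: module.subspace_def vector_space_def module_def intro: rep_add rep_scl)
  have pos: "0 < Re (ip \<phi> \<phi>)" if "\<exists>v. rep \<phi> v" "\<phi> \<noteq> 0" for \<phi>
    using that F_definite F.form_nonneg[of \<phi>] by force
  have complete: "\<exists>\<phi>\<in>{\<phi>. \<exists>v. rep \<phi> v}. (\<lambda>n. hnorm completion (X n - \<phi>)) \<longlonglongrightarrow> 0"
    if "range X \<subseteq> {\<phi>. \<exists>v. rep \<phi> v}"
      "\<forall>e>0. \<exists>N. \<forall>m\<ge>N. \<forall>n\<ge>N. hnorm completion (X m - X n) < e" for X
    using F_complete[of X] that unfolding F.Cau_def F_diff F_nrm by blast
  have separable: "\<exists>n. hnorm completion (\<phi> - hat (d n)) < e"
    if \<phi>: "\<exists>v. rep \<phi> v" and e: "e > 0" for \<phi> e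
  proof -
    obtain v where v: "rep \<phi> v" using \<phi> by blast
    then have vV: "v k \<in> V" for k by (auto simp: rep_def Cau_in)
    obtain N where N: "\<And>k. k \<ge> N \<Longrightarrow> F.nrm (\<phi> - hat (v k)) < e / 2"
      by (rule rep_approx[OF v, of "e / 2"]) (use e in auto)
    obtain n where n: "nrm (diff (v N) (d n)) < e / 2" using dense[OF vV, of "e / 2"] e by auto
    have "F.nrm (\<phi> - hat (d n)) \<le> F.nrm (\<phi> - hat (v N)) + F.nrm (hat (v N) - hat (d n))"
      using F.nrm_diff_triangle[of \<phi> "hat (v N)" "hat (d n)"] \<phi> by (simp add: F_diff vV hat_in)
    moreover have "F.nrm (hat (v N) - hat (d n)) = nrm (diff (v N) (d n))"
      by (simp add: F_nrm_hat vV flip: hat_diff)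
    ultimately have "F.nrm (\<phi> - hat (d n)) < e" using N[of N] n by linarith
    then show ?thesis unfolding F_nrm by blast
  qed
  show ?thesis
    unfolding hilbert_space_def completion_simps
  proof (intro conjI vs sub ballI allI impI)
    show "\<exists>D\<subseteq>{\<phi>. \<exists>v. rep \<phi> v}. countable D \<and>
        (\<forall>x\<in>{\<phi>. \<exists>v. rep \<phi> v}. \<forall>e>0. \<exists>d\<in>D. hnorm completion (x - d) < e)"
      by (rule exI[of _ "range (\<lambda>n. hat (d n))"]) (use separable in \<open>auto simp: hat_in\<close>)
    fix \<phi> \<psi> \<omega> c
    assume *: "\<phi> \<in> {\<phi>. \<exists>v. rep \<phi> v}" "\<psi> \<in> {\<phi>. \<exists>v. rep \<phi> v}"
    show "ip \<psi> \<phi> = cnj (ip \<phi> \<psi>)" by (rule F.form_sym[OF *])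
    show "ip (\<lambda>n. c * \<phi> n) \<psi> = c * ip \<phi> \<psi>" by (rule F.form_scl_left[OF *])
    assume "\<omega> \<in> {\<phi>. \<exists>v. rep \<phi> v}"
    then show "ip (\<phi> + \<psi>) \<omega> = ip \<phi> \<omega> + ip \<psi> \<omega>" by (rule F.form_add_left[OF *])
  qed (use pos complete in blast)+
qed

text \<open>Index maps are only determined up to repetitions in \<open>d\<close>. This lemma lets
  such maps be compared through the vectors they select.\<close>

lemma rep_cong: "rep \<phi> v \<Longrightarrow> d m = d n \<Longrightarrow> \<phi> m = \<phi> n"
  unfolding rep_def by (metis LIMSEQ_unique)

end

section \<open>Hilbert spaces and the extension of formally adjoint operators\<close>

locale hilbert =
  fixes E :: "'v::ab_group_add hilb"
  assumes hilbert_space: "hilbert_space E"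
begin

sublocale vs: vector_space "hscale E"
  using hilbert_space by (simp add: hilbert_space_def)

lemma subspace: "vs.subspace (hset E)"
  using hilbert_space by (simp add: hilbert_space_def)

lemmas hset_zero [simp] = vs.subspace_0[OF subspace]

lemma hinner_axioms:
  "\<forall>x\<in>hset E. \<forall>y\<in>hset E. \<forall>z\<in>hset E. hinner E (x + y) z = hinner E x z + hinner E y z"
  "\<forall>c. \<forall>x\<in>hset E. \<forall>y\<in>hset E. hinner E (hscale E c x) y = c * hinner E x y"
  "\<forall>x\<in>hset E. \<forall>y\<in>hset E. hinner E y x = cnj (hinner E x y)"
  "\<forall>x\<in>hset E. x \<noteq> 0 \<longrightarrow> 0 < Re (hinner E x x)"
  using hilbert_space unfolding hilbert_space_def by - (elim conjE, assumption)+

sublocale psd_form "hset E" plus "hscale E" "hinner E"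
proof (unfold_locales, goal_cases)
  case (1 x y) then show ?case by (rule vs.subspace_add[OF subspace])
next
  case (2 x c) then show ?case by (rule vs.subspace_scale[OF subspace])
next
  case (3 x y z) then show ?case by (rule hinner_axioms(1)[rule_format])
next
  case (4 x y c) then show ?case by (rule hinner_axioms(2)[rule_format])
next
  case (5 x y) then show ?case by (rule hinner_axioms(3)[rule_format])
next
  case (6 x)
  show ?case
  proof (cases "x = 0")
    case True
    have "hinner E (0 + 0) 0 = hinner E 0 0 + hinner E 0 0"
      by (rule hinner_axioms(1)[rule_format]) (rule hset_zero)+
    then show ?thesis by (simp add: True)
  next
    case False
    then show ?thesis using hinner_axioms(4)[rule_format, OF 6] by simp
  qed
qed

lemma diff_eq: "diff x y = x - y"
  unfolding diff_def vs.scale_minus_left vs.scale_one by (rule add_uminus_conv_diff)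

lemma nrm_eq: "nrm = hnorm E"
  by (simp add: fun_eq_iff nrm_def hnorm_def)

lemma hdiff_closed [simp]: "x \<in> hset E \<Longrightarrow> y \<in> hset E \<Longrightarrow> x - y \<in> hset E"
  using diff_closed by (simp add: diff_eq)

lemma definite: "x \<in> hset E \<Longrightarrow> Re (hinner E x x) = 0 \<Longrightarrow> x = 0"
  using hinner_axioms(4) by force

lemma adj_eqI:
  assumes w: "w \<in> hset E" and eq: "\<And>x. x \<in> hset E \<Longrightarrow> hinner E (T x) y = hinner E x w"
  shows "adj E T y = w"
  unfolding adj_def
proof (rule the_equality)
  show "w \<in> hset E \<and> (\<forall>x\<in>hset E. hinner E (T x) y = hinner E x w)" using assms by blast
next
  fix w' assume w': "w' \<in> hset E \<and> (\<forall>x\<in>hset E. hinner E (T x) y = hinner E x w')"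
  then have "hinner E (w - w') (diff w w') = 0"
    using w eq[of "w - w'"] form_diff_right[of "w - w'" w w'] by simp
  then have "w - w' = 0" using w w' by (intro definite) (auto simp: diff_eq)
  then show "w' = w" by simp
qed

end

text \<open>Coordinate \<open>n\<close> of the image of a point under \<open>N\<close> is the
  pairing of \<open>N v\<close> with \<open>d n\<close>, hence of \<open>v\<close> with
  \<open>M (d n) = d (\<sigma> n)\<close>. So \<open>\<sigma>\<close> records \<open>M\<close>, yet
  composition with \<open>\<sigma>\<close> extends \<open>N\<close>; \<open>\<tau>\<close> serves
  \<open>M\<close> in the same way.\<close>

locale adjoint_pair = dense_psd_form +
  fixes N M :: "'a \<Rightarrow> 'a" and R :: real and \<sigma> \<tau> :: "nat \<Rightarrow> nat"
  assumes N_in [simp]: "x \<in> V \<Longrightarrow> N x \<in> V" and M_in [simp]: "x \<in> V \<Longrightarrow> M x \<in> V"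
    and adjoint: "x \<in> V \<Longrightarrow> y \<in> V \<Longrightarrow> B (N x) y = B x (M y)"
    and N_bound: "x \<in> V \<Longrightarrow> nrm (N x) \<le> R * nrm x"
    and M_bound: "x \<in> V \<Longrightarrow> nrm (M x) \<le> R * nrm x"
    and \<sigma>: "d (\<sigma> n) = M (d n)" and \<tau>: "d (\<tau> n) = N (d n)"
begin

lemma swap: "adjoint_pair V add scl B d M N R \<tau> \<sigma>"
proof unfold_locales
  fix x y assume "x \<in> V" "y \<in> V"
  then show "B (M x) y = B x (N y)"
    using adjoint[of y x] form_sym[of "M x" y] form_sym[of "N y" x] by simp
qed (auto simp: \<sigma> \<tau> N_bound M_bound)

lemma Cau_N:
  assumes "Cau v"
  shows "Cau (\<lambda>k. N (v k))"
proof (rule Cau_image[OF assms])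
  fix x y assume xy: "x \<in> V" "y \<in> V"
  \<comment> \<open>Linearity of \<open>N\<close> is not assumed; the adjoint relation yields it up
    to null vectors.\<close>
  have eq: "B (diff (N x) (N y)) z = B (N (diff x y)) z" if "z \<in> V" for z
    using that xy by (simp add: form_diff_left adjoint)
  have "B (diff (N x) (N y)) (diff (N x) (N y)) = B (N (diff x y)) (N (diff x y))"
    using xy by (metis eq form_sym N_in diff_closed)
  then have "nrm (diff (N x) (N y)) = nrm (N (diff x y))" by (simp add: nrm_def)
  then show "nrm (diff (N x) (N y)) \<le> R * nrm (diff x y)"
    using xy N_bound[of "diff x y"] by simp
qed auto

lemma rep_N: "rep \<phi> v \<Longrightarrow> rep (\<phi> \<circ> \<sigma>) (\<lambda>k. N (v k))"
  by (auto simp: rep_def Cau_N Cau_in adjoint simp flip: \<sigma>)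

lemma hat_N: "x \<in> V \<Longrightarrow> hat (N x) = hat x \<circ> \<sigma>"
  by (simp add: hat_def fun_eq_iff adjoint \<sigma>)

lemma bounded_operator_N: "bounded_operator completion (\<lambda>\<phi>. \<phi> \<circ> \<sigma>)"
  unfolding bounded_operator_def linear_map_def
proof (intro conjI exI[of _ R] ballI allI)
  fix \<phi> assume "\<phi> \<in> hset completion"
  then obtain v where v: "rep \<phi> v" by auto
  then have "v k \<in> V" for k by (simp add: rep_def Cau_in)
  then show "hnorm completion (\<phi> \<circ> \<sigma>) \<le> R * hnorm completion \<phi>"
    unfolding F_nrm[symmetric]
    by (intro LIMSEQ_le[OF nrm_lim[OF rep_N[OF v]] tendsto_mult_left[OF nrm_lim[OF v]]])
      (auto simp: N_bound)
qed (auto simp: fun_eq_iff intro: rep_N)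

lemma adj_N:
  assumes \<phi>: "\<phi> \<in> hset completion"
  shows "adj completion (\<lambda>\<phi>. \<phi> \<circ> \<sigma>) \<phi> = \<phi> \<circ> \<tau>"
proof -
  interpret H: hilbert completion by unfold_locales (rule hilbert_space_completion)
  interpret S: adjoint_pair V add scl B d M N R \<tau> \<sigma> by (rule swap)
  obtain v where v: "rep \<phi> v" using \<phi> by auto
  show ?thesis
  proof (rule H.adj_eqI)
    show "\<phi> \<circ> \<tau> \<in> hset completion" using S.rep_N[OF v] by auto
    fix \<psi> assume "\<psi> \<in> hset completion"
    then obtain w where w: "rep \<psi> w" by auto
    have "v k \<in> V" "w k \<in> V" for k using v w by (auto simp: rep_def Cau_in)
    then have "B (N (w k)) (v k) = B (w k) (M (v k))" for k by (rule adjoint[rotated])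
    then have "(\<lambda>k. B (w k) (M (v k))) \<longlonglongrightarrow> ip (\<psi> \<circ> \<sigma>) \<phi>"
      using ip_lim[OF rep_N[OF w] v] by simp
    then show "hinner completion (\<psi> \<circ> \<sigma>) \<phi> = hinner completion \<psi> (\<phi> \<circ> \<tau>)"
      using LIMSEQ_unique[OF _ ip_lim[OF w S.rep_N[OF v]]] by simp
  qed
qed

text \<open>The index maps themselves need not commute. It is enough that both orders of composition
  select the same vector of the dense sequence.\<close>

lemma normal_operator_N:
  assumes NM: "\<And>n. N (M (d n)) = M (N (d n))"
  shows "normal_operator completion (\<lambda>\<phi>. \<phi> \<circ> \<sigma>)"
  unfolding normal_operator_def
proof (intro conjI bounded_operator_N ballI)
  fix \<phi> assume \<phi>: "\<phi> \<in> hset completion"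
  then obtain v where v: "rep \<phi> v" by auto
  have "\<phi> \<circ> \<tau> \<circ> \<sigma> = \<phi> \<circ> \<sigma> \<circ> \<tau>"
  proof
    fix n
    have "d (\<tau> (\<sigma> n)) = d (\<sigma> (\<tau> n))" by (simp add: \<sigma> \<tau> NM)
    then show "(\<phi> \<circ> \<tau> \<circ> \<sigma>) n = (\<phi> \<circ> \<sigma> \<circ> \<tau>) n"
      unfolding o_apply by (rule rep_cong[OF v])
  qed
  moreover have "\<phi> \<circ> \<sigma> \<in> hset completion" using rep_N[OF v] by auto
  ultimately show "adj completion (\<lambda>\<phi>. \<phi> \<circ> \<sigma>) \<phi> \<circ> \<sigma> = adj completion (\<lambda>\<phi>. \<phi> \<circ> \<sigma>) (\<phi> \<circ> \<sigma>)"
    using \<phi> by (simp add: adj_N)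
qed

end

section \<open>Riesz representation and existence of adjoints\<close>

context hilbert
begin

lemma Cau_converges:
  assumes "Cau X"
  shows "\<exists>x\<in>hset E. (\<lambda>n. nrm (diff (X n) x)) \<longlonglongrightarrow> 0"
proof -
  have "\<forall>X. range X \<subseteq> hset E \<longrightarrow>
      (\<forall>e>0. \<exists>N. \<forall>m\<ge>N. \<forall>n\<ge>N. hnorm E (X m - X n) < e) \<longrightarrow>
      (\<exists>x\<in>hset E. (\<lambda>n. hnorm E (X n - x)) \<longlonglongrightarrow> 0)"
    using hilbert_space unfolding hilbert_space_def by - (elim conjE, assumption)
  then show ?thesis using assms unfolding Cau_def diff_eq nrm_eq by blast
qed

text \<open>If \<open>v\<close> represents \<open>f\<close>, then \<open>g w\<close> is the squared
  norm of \<open>w - v\<close> minus that of \<open>v\<close>. The vector is therefore sought as a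
  minimiser of \<open>g\<close>, and completeness turns a minimising sequence into one.\<close>

lemma Riesz_representation:
  fixes f :: "'v \<Rightarrow> complex"
  assumes f_add: "\<And>x y. x \<in> hset E \<Longrightarrow> y \<in> hset E \<Longrightarrow> f (x + y) = f x + f y"
    and f_scl: "\<And>c x. x \<in> hset E \<Longrightarrow> f (hscale E c x) = c * f x"
    and f_bound: "\<And>x. x \<in> hset E \<Longrightarrow> cmod (f x) \<le> C * nrm x"
  shows "\<exists>w\<in>hset E. \<forall>x\<in>hset E. f x = hinner E x w"
proof -
  define g where "g w = Re (hinner E w w) - 2 * Re (f w)" for w
  have "- (C\<^sup>2) \<le> g w" if "w \<in> hset E" for w
  proof -
    have "Re (f w) \<le> C * nrm w"
      using complex_Re_le_cmod[of "f w"] f_bound[OF that] by linarith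
    moreover have "0 \<le> (nrm w - C)\<^sup>2" by simp
    ultimately show ?thesis
      unfolding g_def nrm_square[OF that, symmetric] by (simp add: power2_diff algebra_simps)
  qed
  then have bdd: "bdd_below (g ` hset E)" by (intro bdd_belowI2)
  define I where "I = Inf (g ` hset E)"
  have I_le: "I \<le> g w" if "w \<in> hset E" for w
    unfolding I_def using bdd that by (intro cInf_lower) auto
  have "\<exists>w\<in>hset E. g w < I + 1 / real (Suc k)" for k
  proof -
    have ne: "g ` hset E \<noteq> {}" using hset_zero by blast
    have "Inf (g ` hset E) < I + 1 / real (Suc k)" unfolding I_def by simp
    from cInf_lessD[OF ne this] show ?thesis by blast
  qed
  then obtain w where w: "\<And>k. w k \<in> hset E" "\<And>k. g (w k) < I + 1 / real (Suc k)" by metis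
  note [simp] = w(1)
  have parallelogram: "(nrm (diff a b))\<^sup>2 \<le> 2 * (g a - I) + 2 * (g b - I)"
    if [simp]: "a \<in> hset E" "b \<in> hset E" for a b
  proof -
    \<comment> \<open>The value of \<open>g\<close> at the midpoint is at least \<open>I\<close>, so
      two near-minimisers are close to each other.\<close>
    define m where "m = hscale E (1/2) (a + b)"
    have m: "m \<in> hset E" by (simp add: m_def)
    have "Re (hinner E b a) = Re (hinner E a b)" using form_sym[of a b] by simp
    then have "(nrm (diff a b))\<^sup>2 = 2 * g a + 2 * g b - 4 * g m"
      unfolding nrm_square[OF diff_closed[OF that]] g_def m_def
      by (simp add: form_diff_left form_diff_right form_add_left form_add_right form_scl_left
          form_scl_right f_add f_scl algebra_simps)
    then show ?thesis using I_le[OF m] by simp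
  qed
  have "Cau w"
    unfolding Cau_def
  proof (intro conjI allI impI)
    show "range w \<subseteq> hset E" by auto
    fix e :: real assume e: "e > 0"
    obtain N where N: "1 / real (Suc N) < e\<^sup>2 / 4"
      using reals_Archimedean[of "e\<^sup>2 / 4"] e by (auto simp: inverse_eq_divide)
    show "\<exists>N. \<forall>i\<ge>N. \<forall>j\<ge>N. nrm (diff (w i) (w j)) < e"
    proof (intro exI[of _ N] allI impI)
      fix i j assume ij: "N \<le> i" "N \<le> j"
      have *: "g (w k) - I < e\<^sup>2 / 4" if "N \<le> k" for k
      proof -
        have "1 / real (Suc k) \<le> 1 / real (Suc N)" using that by (simp add: frac_le)
        then show ?thesis using w(2)[of k] N by linarith
      qed
      have "(nrm (diff (w i) (w j)))\<^sup>2 \<le> 2 * (g (w i) - I) + 2 * (g (w j) - I)"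
        by (rule parallelogram) simp_all
      also have "\<dots> < 2 * (e\<^sup>2 / 4) + 2 * (e\<^sup>2 / 4)"
        using *[OF ij(1)] *[OF ij(2)] by (intro add_strict_mono mult_strict_left_mono) auto
      finally have "(nrm (diff (w i) (w j)))\<^sup>2 < e\<^sup>2" by simp
      then show "nrm (diff (w i) (w j)) < e" using e by (simp add: power2_less_imp_less)
    qed
  qed
  then obtain v where v: "v \<in> hset E" "(\<lambda>n. nrm (diff (w n) v)) \<longlonglongrightarrow> 0"
    using Cau_converges by blast
  note [simp] = v(1)
  have Re_eq: "Re (hinner E v x) = Re (f x)" if x: "x \<in> hset E" for x
  proof -
    note [simp] = x
    define a where "a = Re (hinner E v x) - Re (f x)"
    define n where "n = Re (hinner E x x)"
    have "(\<lambda>k. hinner E (diff (w k) v) x) \<longlonglongrightarrow> 0"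
    proof (rule Lim_null_comparison)
      show "\<forall>\<^sub>F k in sequentially. cmod (hinner E (diff (w k) v) x) \<le> nrm (diff (w k) v) * nrm x"
        by (simp add: Cauchy_Schwarz)
      show "(\<lambda>k. nrm (diff (w k) v) * nrm x) \<longlonglongrightarrow> 0" using v(2) by (rule tendsto_mult_left_zero)
    qed
    then have "(\<lambda>k. hinner E (diff (w k) v) x + hinner E v x) \<longlonglongrightarrow> 0 + hinner E v x"
      by (intro tendsto_add tendsto_const)
    then have lim: "(\<lambda>k. Re (hinner E (w k) x)) \<longlonglongrightarrow> Re (hinner E v x)"
      by (intro tendsto_Re) (simp add: form_diff_left)
    \<comment> \<open>A move by \<open>t\<close> times \<open>x\<close> cannot take \<open>g\<close>
      below \<open>I\<close>, while \<open>g (w k)\<close> exceeds \<open>I\<close> by less than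
      \<open>1 / (k + 1)\<close>. In the limit only the quadratic in \<open>t\<close>
      remains.\<close>
    have key: "0 \<le> t\<^sup>2 * n + 2 * t * a" for t :: real
    proof -
      have "- (1 / real (Suc k)) \<le> t\<^sup>2 * n + 2 * t * (Re (hinner E (w k) x) - Re (f x))" for k
      proof -
        let ?z = "w k + hscale E (complex_of_real t) x"
        have "Re (hinner E x (w k)) = Re (hinner E (w k) x)" using form_sym[of "w k" x] by simp
        then have "g ?z = g (w k) + t\<^sup>2 * n + 2 * t * (Re (hinner E (w k) x) - Re (f x))"
          by (simp add: g_def n_def form_add_left form_add_right form_scl_left form_scl_right
              f_add f_scl power2_eq_square algebra_simps)
        with I_le[of ?z] w(2)[of k] show ?thesis by simp
      qed
      moreover have "(\<lambda>k. - (1 / real (Suc k))) \<longlonglongrightarrow> 0"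
        using tendsto_minus[OF LIMSEQ_inverse_real_of_nat] by (simp add: inverse_eq_divide)
      moreover have "(\<lambda>k. t\<^sup>2 * n + 2 * t * (Re (hinner E (w k) x) - Re (f x)))
          \<longlonglongrightarrow> t\<^sup>2 * n + 2 * t * a"
        unfolding a_def by (intro tendsto_intros lim)
      ultimately show ?thesis by (intro LIMSEQ_le[of _ 0 _ "t\<^sup>2 * n + 2 * t * a"]) auto
    qed
    have n: "n \<ge> 0" by (simp add: n_def form_nonneg)
    have "a = 0"
    proof (rule ccontr)
      assume "a \<noteq> 0"
      \<comment> \<open>The denominator \<open>n + 1\<close> is nonzero even for
        \<open>x = 0\<close>; multiplied by \<open>(n + 1)\<^sup>2\<close>, the quadratic becomes
        \<open>- (a\<^sup>2 * (n + 2))\<close>.\<close>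
      define t where "t = - a / (n + 1)"
      have t: "t * (n + 1) = - a" using n by (simp add: t_def)
      have "0 \<le> (n + 1)\<^sup>2 * (t\<^sup>2 * n + 2 * t * a)" using key[of t] by simp
      also have "\<dots> = (t * (n + 1))\<^sup>2 * n + 2 * (t * (n + 1)) * (n + 1) * a"
        by (simp add: power2_eq_square algebra_simps)
      also have "\<dots> = - (a\<^sup>2 * (n + 2))" unfolding t by (simp add: power2_eq_square algebra_simps)
      finally show False using n \<open>a \<noteq> 0\<close> by (simp add: mult_le_0_iff)
    qed
    then show ?thesis by (simp add: a_def)
  qed
  have "f x = hinner E x v" if x: "x \<in> hset E" for x
  proof -
    \<comment> \<open>The real identity at \<i> times \<open>x\<close> is the one for imaginary
      parts; the sign stems from conjugate-linearity in the second argument.\<close>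
    have "Im (hinner E v x) = - Im (f x)"
      using Re_eq[of "hscale E \<i> x"] x by (simp add: form_scl_right f_scl)
    then show ?thesis using Re_eq[OF x] form_sym[of v x] x by (simp add: complex_eq_iff)
  qed
  then show ?thesis using v(1) by blast
qed

lemma adj_props:
  assumes T: "bounded_operator E T" and y: "y \<in> hset E"
  shows "adj E T y \<in> hset E" "x \<in> hset E \<Longrightarrow> hinner E (T x) y = hinner E x (adj E T y)"
proof -
  have T_in: "\<And>x. x \<in> hset E \<Longrightarrow> T x \<in> hset E"
    and T_add: "\<And>x x'. x \<in> hset E \<Longrightarrow> x' \<in> hset E \<Longrightarrow> T (x + x') = T x + T x'"
    and T_scl: "\<And>c x. x \<in> hset E \<Longrightarrow> T (hscale E c x) = hscale E c (T x)"
    using T by (auto simp: bounded_operator_def linear_map_def)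
  obtain K where K: "\<And>x. x \<in> hset E \<Longrightarrow> nrm (T x) \<le> K * nrm x"
    using T by (auto simp: bounded_operator_def nrm_eq)
  have "\<exists>w\<in>hset E. \<forall>x\<in>hset E. hinner E (T x) y = hinner E x w"
  proof (rule Riesz_representation)
    fix x assume x: "x \<in> hset E"
    have "cmod (hinner E (T x) y) \<le> nrm (T x) * nrm y" using x y T_in by (simp add: Cauchy_Schwarz)
    also have "\<dots> \<le> K * nrm x * nrm y" using x y K by (intro mult_right_mono) (auto simp: nrm_nonneg)
    finally show "cmod (hinner E (T x) y) \<le> K * nrm y * nrm x" by (simp add: mult_ac)
  qed (use y in \<open>simp_all add: T_in T_add T_scl form_add_left form_scl_left\<close>)
  then obtain w where w: "w \<in> hset E" "\<And>x. x \<in> hset E \<Longrightarrow> hinner E (T x) y = hinner E x w" by blast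
  have "adj E T y = w" using w by (rule adj_eqI)
  then show "adj E T y \<in> hset E" "x \<in> hset E \<Longrightarrow> hinner E (T x) y = hinner E x (adj E T y)"
    using w by auto
qed

lemma hinner_zero_left: "x \<in> hset E \<Longrightarrow> hinner E 0 x = 0"
  using form_add_left[of 0 0 x] by simp

lemma hset_sum: "(\<And>i. i \<in> S \<Longrightarrow> g i \<in> hset E) \<Longrightarrow> sum g S \<in> hset E"
  by (rule vs.subspace_sum[OF subspace])

lemma hinner_sum_left:
  assumes "y \<in> hset E" "\<And>i. i \<in> S \<Longrightarrow> g i \<in> hset E"
  shows "hinner E (sum g S) y = (\<Sum>i\<in>S. hinner E (g i) y)"
  using assms(2)
proof (induction S rule: infinite_finite_induct)
  case (insert i S)
  then show ?case using assms(1) by (simp add: form_add_left hset_sum)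
qed (simp_all add: hinner_zero_left assms(1))

end

section \<open>Functionals on the polynomial ring and the hereditary calculus\<close>

definition lin :: "('m \<Rightarrow> complex) \<Rightarrow> ('m \<Rightarrow>\<^sub>0 complex) \<Rightarrow> complex"
  where "lin \<phi> f = (\<Sum>m\<in>Poly_Mapping.keys f. Poly_Mapping.lookup f m * \<phi> m)"

lemma lin_superset:
  "finite S \<Longrightarrow> Poly_Mapping.keys f \<subseteq> S \<Longrightarrow> lin \<phi> f = (\<Sum>m\<in>S. Poly_Mapping.lookup f m * \<phi> m)"
  unfolding lin_def by (intro sum.mono_neutral_left) (auto simp: in_keys_iff)

lemma lin_zero [simp]: "lin \<phi> 0 = 0"
  by (simp add: lin_def)

lemma lin_single [simp]: "lin \<phi> (Poly_Mapping.single m c) = c * \<phi> m"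
  by (simp add: lin_def)

lemma lin_add: "lin \<phi> (f + g) = lin \<phi> f + lin \<phi> g"
proof -
  let ?S = "Poly_Mapping.keys f \<union> Poly_Mapping.keys g"
  have "lin \<phi> (f + g) = (\<Sum>m\<in>?S. Poly_Mapping.lookup (f + g) m * \<phi> m)"
    using Poly_Mapping.keys_add[of f g] by (intro lin_superset) auto
  also have "\<dots> = (\<Sum>m\<in>?S. Poly_Mapping.lookup f m * \<phi> m) + (\<Sum>m\<in>?S. Poly_Mapping.lookup g m * \<phi> m)"
    by (simp add: lookup_add distrib_right sum.distrib)
  also have "\<dots> = lin \<phi> f + lin \<phi> g" by (simp add: lin_superset[of ?S])
  finally show ?thesis .
qed

lemma lin_mult:
  fixes f g :: "'n cpoly"
  assumes "\<And>m k. \<phi> (m + k) = \<phi> m * \<phi> k"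
  shows "lin \<phi> (f * g) = lin \<phi> f * lin \<phi> g"
proof (induction f rule: cpoly_induct)
  case (2 m c)
  show ?case
    by (induction g rule: cpoly_induct) (simp_all add: mult_single assms distrib_left lin_add)
qed (simp_all add: distrib_right lin_add)

lemma evaluate_eq_lin: "evaluate f a =
    lin (\<lambda>(\<alpha>, \<beta>). (\<Prod>j\<in>UNIV. (a $ j) ^ Poly_Mapping.lookup \<alpha> j) *
      (\<Prod>j\<in>UNIV. cnj (a $ j) ^ Poly_Mapping.lookup \<beta> j)) f"
  by (auto simp: evaluate_def lin_def intro!: sum.cong)

lemma evaluate_mult: "evaluate (f * g) a = evaluate f a * evaluate g a"
  unfolding evaluate_eq_lin
  by (rule lin_mult) (auto simp: lookup_add power_add prod.distrib)

lemma evaluate_add: "evaluate (f + g) a = evaluate f a + evaluate g a"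
  by (simp add: evaluate_eq_lin lin_add)

lemma evaluate_const_poly: "evaluate (const_poly c) a = c"
  by (simp add: evaluate_eq_lin const_poly_def zero_prod_def)

lemma const_poly_add: "const_poly (c + d) = const_poly c + const_poly d"
  by (simp add: const_poly_def single_add)

lemma const_poly_mult: "const_poly (c * d) = const_poly c * const_poly d"
  by (simp add: const_poly_def mult_single)

lemma const_poly_1: "const_poly 1 = 1"
  by (simp add: const_poly_def)

lemma enumeration: "distinct (enumeration :: 'n::finite list)" "set (enumeration :: 'n list) = UNIV"
  using someI_ex[OF finite_distinct_list[of "UNIV :: 'n set"]]
  unfolding enumeration_def by (auto simp: conj_commute)

text \<open>The enumeration in \<open>multipower\<close> is replaced by an arbitrary list, over
  which induction is possible.\<close>

definition powers :: "('n \<Rightarrow> 'v \<Rightarrow> 'v) \<Rightarrow> 'n list \<Rightarrow> ('n \<Rightarrow>\<^sub>0 nat) \<Rightarrow> 'v \<Rightarrow> 'v"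
  where "powers T js \<alpha> = foldr (\<lambda>j g. (T j ^^ Poly_Mapping.lookup \<alpha> j) \<circ> g) js id"

lemma powers_simps [simp]:
  "powers T [] \<alpha> x = x"
  "powers T (j # js) \<alpha> x = (T j ^^ Poly_Mapping.lookup \<alpha> j) (powers T js \<alpha> x)"
  by (simp_all add: powers_def)

lemma multipower_eq: "multipower T \<alpha> = powers T enumeration \<alpha>"
  by (simp add: multipower_def powers_def)

lemma powers_zero: "powers T js 0 x = x"
  by (induction js) auto

locale bounded_commuting_tuple = hilbert E for E :: "'v::ab_group_add hilb" +
  fixes T :: "'n::finite \<Rightarrow> 'v \<Rightarrow> 'v" and R :: real
  assumes bounded: "bounded_operator E (T j)"
    and commuting: "commuting E T"
    and R_pos: "R > 0"
    and T_bound: "x \<in> hset E \<Longrightarrow> nrm (T j x) \<le> R * nrm x"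
begin

lemma T_in [simp]: "x \<in> hset E \<Longrightarrow> T j x \<in> hset E"
  and T_add: "x \<in> hset E \<Longrightarrow> y \<in> hset E \<Longrightarrow> T j (x + y) = T j x + T j y"
  and T_scl: "x \<in> hset E \<Longrightarrow> T j (hscale E c x) = hscale E c (T j x)"
  using bounded[of j] by (auto simp: bounded_operator_def linear_map_def)

lemma T_commute: "x \<in> hset E \<Longrightarrow> T i (T j x) = T j (T i x)"
  using commuting by (auto simp: commuting_def)

lemma T_power_in [simp]: "x \<in> hset E \<Longrightarrow> (T j ^^ k) x \<in> hset E"
  by (induction k) auto

lemma T_power_add: "x \<in> hset E \<Longrightarrow> y \<in> hset E \<Longrightarrow> (T j ^^ k) (x + y) = (T j ^^ k) x + (T j ^^ k) y"
  by (induction k) (auto simp: T_add)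

lemma T_power_scl: "x \<in> hset E \<Longrightarrow> (T j ^^ k) (hscale E c x) = hscale E c ((T j ^^ k) x)"
  by (induction k) (auto simp: T_scl)

lemma T_power_commute1: "x \<in> hset E \<Longrightarrow> T i ((T j ^^ k) x) = (T j ^^ k) (T i x)"
  by (induction k) (auto simp: T_commute[of _ i j])

lemma T_power_commute: "x \<in> hset E \<Longrightarrow> (T i ^^ l) ((T j ^^ k) x) = (T j ^^ k) ((T i ^^ l) x)"
  by (induction l) (auto simp: T_power_commute1)

lemma powers_in [simp]: "x \<in> hset E \<Longrightarrow> powers T js \<alpha> x \<in> hset E"
  by (induction js) auto

lemma powers_additive:
  "x \<in> hset E \<Longrightarrow> y \<in> hset E \<Longrightarrow> powers T js \<alpha> (x + y) = powers T js \<alpha> x + powers T js \<alpha> y"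
  by (induction js) (auto simp: T_power_add)

lemma powers_scl: "x \<in> hset E \<Longrightarrow> powers T js \<alpha> (hscale E c x) = hscale E c (powers T js \<alpha> x)"
  by (induction js) (auto simp: T_power_scl)

lemma powers_commute: "x \<in> hset E \<Longrightarrow> (T i ^^ k) (powers T js \<alpha> x) = powers T js \<alpha> ((T i ^^ k) x)"
proof (induction js)
  case (Cons j js)
  then show ?case by (simp add: T_power_commute[where i = i and l = k])
qed simp

lemma powers_add: "x \<in> hset E \<Longrightarrow> powers T js (\<alpha> + \<beta>) x = powers T js \<alpha> (powers T js \<beta> x)"
proof (induction js)
  case (Cons j js)
  then show ?case
    by (simp add: lookup_add funpow_add powers_commute)
qed simp

lemma powers_single:
  "distinct js \<Longrightarrow> powers T js (Poly_Mapping.single i (Suc 0)) x = (if i \<in> set js then T i x else x)"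
  by (induction js) (auto simp: lookup_single when_def)

lemma powers_bound: "\<exists>K. \<forall>x\<in>hset E. nrm (powers T js \<alpha> x) \<le> K * nrm x"
proof (induction js)
  case Nil
  show ?case by (intro exI[of _ 1]) simp
next
  case (Cons j js)
  then obtain K where K: "\<And>x. x \<in> hset E \<Longrightarrow> nrm (powers T js \<alpha> x) \<le> K * nrm x" by blast
  have T: "nrm ((T j ^^ k) x) \<le> R ^ k * nrm x" if x: "x \<in> hset E" for k x
  proof (induction k)
    case (Suc k)
    have "nrm (T j ((T j ^^ k) x)) \<le> R * nrm ((T j ^^ k) x)" using x by (intro T_bound) simp
    also have "\<dots> \<le> R * (R ^ k * nrm x)" using Suc R_pos by (intro mult_left_mono) auto
    finally show ?case by simp
  qed simp
  let ?k = "Poly_Mapping.lookup \<alpha> j"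
  have "nrm (powers T (j # js) \<alpha> x) \<le> R ^ ?k * K * nrm x" if x: "x \<in> hset E" for x
  proof -
    have "nrm (powers T (j # js) \<alpha> x) \<le> R ^ ?k * nrm (powers T js \<alpha> x)" using T x by simp
    also have "\<dots> \<le> R ^ ?k * (K * nrm x)" using K[OF x] R_pos by (intro mult_left_mono) auto
    finally show ?thesis by simp
  qed
  then show ?case by blast
qed

lemma adj_power:
  "x \<in> hset E \<Longrightarrow> (adj E (T j) ^^ k) x \<in> hset E"
  "x \<in> hset E \<Longrightarrow> y \<in> hset E \<Longrightarrow> hinner E ((adj E (T j) ^^ k) x) y = hinner E x ((T j ^^ k) y)"
proof -
  have in': "(adj E (T j) ^^ k) x \<in> hset E" if "x \<in> hset E" for x k
    using that by (induction k) (auto simp: adj_props[OF bounded])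
  show "hinner E ((adj E (T j) ^^ k) x) y = hinner E x ((T j ^^ k) y)"
    if "x \<in> hset E" "y \<in> hset E" using that
  proof (induction k arbitrary: y)
    case (Suc k)
    let ?z = "(adj E (T j) ^^ k) x"
    have z: "?z \<in> hset E" using Suc.prems by (simp add: in')
    have "hinner E (adj E (T j) ?z) y = hinner E ?z (T j y)"
      using adj_props[OF bounded z] form_sym[OF _ adj_props(1)[OF bounded z], of y] form_sym[of "T j y" ?z]
        Suc.prems z by simp
    then show ?case using Suc by (simp add: funpow_swap1)
  qed simp
qed (use adj_props[OF bounded] in \<open>induction k; auto\<close>)

text \<open>Passing to the adjoint reverses the order of the factors, and
  \<open>powers_commute\<close> restores it on the side of \<open>T\<close>. Commutation of the
  adjoints among themselves is thereby avoided.\<close>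

lemma powers_adj:
  "x \<in> hset E \<Longrightarrow> powers (\<lambda>j. adj E (T j)) js \<beta> x \<in> hset E"
  "x \<in> hset E \<Longrightarrow> y \<in> hset E \<Longrightarrow>
    hinner E (powers (\<lambda>j. adj E (T j)) js \<beta> x) y = hinner E x (powers T js \<beta> y)"
proof -
  have in': "powers (\<lambda>j. adj E (T j)) js \<beta> x \<in> hset E" if "x \<in> hset E" for x js
    using that by (induction js) (auto simp: adj_power)
  then show "x \<in> hset E \<Longrightarrow> powers (\<lambda>j. adj E (T j)) js \<beta> x \<in> hset E" .
  show "hinner E (powers (\<lambda>j. adj E (T j)) js \<beta> x) y = hinner E x (powers T js \<beta> y)"
    if "x \<in> hset E" "y \<in> hset E" using that
    by (induction js arbitrary: y) (simp_all add: adj_power in' powers_commute)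
qed

definition mp :: "('n \<Rightarrow>\<^sub>0 nat) \<Rightarrow> 'v \<Rightarrow> 'v"
  where "mp = multipower T"

lemma mp_in [simp]: "x \<in> hset E \<Longrightarrow> mp \<alpha> x \<in> hset E"
  and mp_additive: "x \<in> hset E \<Longrightarrow> y \<in> hset E \<Longrightarrow> mp \<alpha> (x + y) = mp \<alpha> x + mp \<alpha> y"
  and mp_scl: "x \<in> hset E \<Longrightarrow> mp \<alpha> (hscale E c x) = hscale E c (mp \<alpha> x)"
  and mp_add: "x \<in> hset E \<Longrightarrow> mp (\<alpha> + \<beta>) x = mp \<alpha> (mp \<beta> x)"
  and mp_zero [simp]: "mp 0 x = x"
  and mp_single: "mp (Poly_Mapping.single j (Suc 0)) x = T j x"
  by (simp_all add: mp_def multipower_eq powers_additive powers_scl powers_add powers_zero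
      powers_single enumeration)

lemma mp_bound: "\<exists>K. \<forall>x\<in>hset E. nrm (mp \<alpha> x) \<le> K * nrm x"
  unfolding mp_def multipower_eq by (rule powers_bound)

text \<open>This is the hereditary calculus paired with \<open>v\<close>: all adjoints stand on the
  left, so they move to \<open>v\<close> as powers of \<open>T\<close>, and no adjoint
  remains.\<close>

definition L :: "'v \<Rightarrow> 'v \<Rightarrow> 'n cpoly \<Rightarrow> complex"
  where "L u v = lin (\<lambda>(\<alpha>, \<beta>). hinner E (mp \<alpha> u) (mp \<beta> v))"

lemma hereditary_inner:
  assumes u: "u \<in> hset E" and v: "v \<in> hset E"
  shows "hinner E (hereditary E T f u) v = L u v f"
proof -
  have "hinner E (hereditary E T f u) v = (\<Sum>m\<in>Poly_Mapping.keys f.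
      hinner E (case m of (\<alpha>, \<beta>) \<Rightarrow> hscale E (Poly_Mapping.lookup f (\<alpha>, \<beta>))
        (multipower (\<lambda>j. adj E (T j)) \<beta> (multipower T \<alpha> u))) v)"
    unfolding hereditary_def
    using u v by (intro hinner_sum_left) (auto simp: multipower_eq powers_adj)
  also have "\<dots> = L u v f"
    unfolding L_def lin_def using u v
    by (intro sum.cong refl) (auto simp: multipower_eq powers_adj form_scl_left mp_def)
  finally show ?thesis .
qed

lemma L_add: "L u v (f + g) = L u v f + L u v g"
  by (simp add: L_def lin_add)

lemma L_zero [simp]: "L u v 0 = 0"
  by (simp add: L_def)

lemma L_single: "L u v (Poly_Mapping.single m c) = c * hinner E (mp (fst m) u) (mp (snd m) v)"
  by (simp add: L_def case_prod_beta)

lemma L_one: "L u v 1 = hinner E u v"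
  by (simp add: L_single flip: single_one)

lemma L_const: "L u v (const_poly c * f) = c * L u v f"
  by (induction f rule: cpoly_induct)
    (simp_all add: const_poly_def mult_single L_single L_add distrib_left)

lemma L_add_left:
  assumes "u \<in> hset E" "u' \<in> hset E" "v \<in> hset E"
  shows "L (u + u') v f = L u v f + L u' v f"
  using assms by (induction f rule: cpoly_induct)
    (simp_all add: L_single mp_additive form_add_left distrib_left L_add)

lemma L_scl_left:
  assumes "u \<in> hset E" "v \<in> hset E"
  shows "L (hscale E c u) v f = c * L u v f"
  using assms by (induction f rule: cpoly_induct)
    (simp_all add: L_single mp_scl form_scl_left distrib_left L_add)

lemma L_star:
  assumes "u \<in> hset E" "v \<in> hset E"
  shows "L v u (star f) = cnj (L u v f)"
proof (induction f rule: cpoly_induct)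
  case (2 m c)
  have "hinner E (mp (snd m) v) (mp (fst m) u) = cnj (hinner E (mp (fst m) u) (mp (snd m) v))"
    using assms by (intro form_sym) auto
  then show ?case by (simp add: L_single star_single)
qed (simp_all add: star_zero star_add L_add)

text \<open>Although \<open>L\<close> is not multiplicative, single variables can be absorbed:
  \<open>zvar j\<close> into the first vector and, in the next lemma, \<open>zbar j\<close> into the
  second.\<close>

lemma L_zvar:
  assumes "u \<in> hset E" "v \<in> hset E"
  shows "L u v (f * zvar j) = L (T j u) v f"
  using assms by (induction f rule: cpoly_induct)
    (simp_all add: L_single L_add distrib_right zvar_def mult_single mp_add mp_single)

lemma L_zbar:
  assumes "u \<in> hset E" "v \<in> hset E"
  shows "L u v (f * zbar j) = L u (T j v) f"
  using assms by (induction f rule: cpoly_induct)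
    (simp_all add: L_single L_add distrib_right zbar_def mult_single mp_add mp_single)

lemma L_bound: "\<exists>C. \<forall>u\<in>hset E. \<forall>v\<in>hset E. cmod (L u v f) \<le> C * nrm u * nrm v"
proof (induction f rule: cpoly_induct)
  case 1
  show ?case by (intro exI[of _ 0]) simp
next
  case (2 m c)
  obtain K where K: "\<And>x. x \<in> hset E \<Longrightarrow> nrm (mp (fst m) x) \<le> K * nrm x" using mp_bound by blast
  obtain K' where K': "\<And>x. x \<in> hset E \<Longrightarrow> nrm (mp (snd m) x) \<le> K' * nrm x" using mp_bound by blast
  have "cmod (L u v (Poly_Mapping.single m c)) \<le> (cmod c * K * K') * nrm u * nrm v"
    if uv: "u \<in> hset E" "v \<in> hset E" for u v
  proof -
    have "cmod (hinner E (mp (fst m) u) (mp (snd m) v)) \<le> nrm (mp (fst m) u) * nrm (mp (snd m) v)"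
      using uv by (intro Cauchy_Schwarz) auto
    also have "\<dots> \<le> (K * nrm u) * (K' * nrm v)"
      using uv K[OF uv(1)] K'[OF uv(2)] nrm_nonneg[of "mp (fst m) u"] nrm_nonneg[of "mp (snd m) v"]
      by (intro mult_mono) auto
    finally have "cmod c * cmod (hinner E (mp (fst m) u) (mp (snd m) v)) \<le>
        cmod c * ((K * nrm u) * (K' * nrm v))" by (intro mult_left_mono) auto
    then show ?thesis by (simp add: L_single norm_mult mult_ac)
  qed
  then show ?case by blast
next
  case (3 f g)
  then obtain C D where C: "\<And>u v. u \<in> hset E \<Longrightarrow> v \<in> hset E \<Longrightarrow> cmod (L u v f) \<le> C * nrm u * nrm v"
    and D: "\<And>u v. u \<in> hset E \<Longrightarrow> v \<in> hset E \<Longrightarrow> cmod (L u v g) \<le> D * nrm u * nrm v" by blast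
  have "cmod (L u v (f + g)) \<le> (C + D) * nrm u * nrm v" if "u \<in> hset E" "v \<in> hset E" for u v
    using norm_triangle_ineq[of "L u v f" "L u v g"] C[OF that] D[OF that]
    by (simp add: L_add distrib_right)
  then show ?case by blast
qed

end

section \<open>Positive weights\<close>

text \<open>Log-convexity says that the ratios of consecutive terms do not decrease. An initial
  ratio \<open>r\<close> above \<open>\<rho>\<close> would force \<open>a k\<close> to be at least
  \<open>a 0 * r ^ k\<close>, which eventually exceeds \<open>C * \<rho> ^ k\<close>.\<close>

lemma log_convex_growth:
  fixes a :: "nat \<Rightarrow> real"
  assumes nonneg: "\<And>k. 0 \<le> a k"
    and convex: "\<And>k. (a (Suc k))\<^sup>2 \<le> a k * a (Suc (Suc k))"
    and growth: "\<And>k. a k \<le> C * \<rho> ^ k" and \<rho>: "\<rho> > 0"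
  shows "a 1 \<le> \<rho> * a 0"
proof (rule ccontr)
  assume "\<not> a 1 \<le> \<rho> * a 0"
  then have less: "\<rho> * a 0 < a 1" by simp
  \<comment> \<open>If \<open>a 0\<close> vanished, convexity at 0 would make \<open>a 1\<close>
    vanish as well.\<close>
  have "a 0 \<noteq> 0" using convex[of 0] less by auto
  with nonneg[of 0] have a0: "a 0 > 0" by simp
  define r where "r = a 1 / a 0"
  have r: "\<rho> < r" using less a0 by (simp add: r_def field_simps)
  with \<rho> have r0: "r > 0" by simp
  have step: "0 < a k \<and> r * a k \<le> a (Suc k)" for k
  proof (induction k)
    case 0
    show ?case using a0 by (simp add: r_def)
  next
    case (Suc k)
    then have pos: "0 < a (Suc k)" using r0 by (metis less_le_trans mult_pos_pos)
    have "a k * (r * a (Suc k)) = (r * a k) * a (Suc k)" by simp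
    also have "\<dots> \<le> a (Suc k) * a (Suc k)" using Suc pos by (intro mult_right_mono) auto
    also have "\<dots> \<le> a k * a (Suc (Suc k))" using convex[of k] by (simp add: power2_eq_square)
    finally show ?case using Suc pos by simp
  qed
  have lower: "a 0 * r ^ k \<le> a k" for k
  proof (induction k)
    case (Suc k)
    have "a 0 * r ^ Suc k = r * (a 0 * r ^ k)" by simp
    also have "\<dots> \<le> r * a k" using Suc r0 by (intro mult_left_mono) auto
    also have "\<dots> \<le> a (Suc k)" using step by blast
    finally show ?case .
  qed simp
  obtain n where n: "C / a 0 < (r / \<rho>) ^ n"
    using real_arch_pow[of "r / \<rho>" "C / a 0"] r \<rho> by auto
  then have "C * \<rho> ^ n < a 0 * r ^ n"
    using a0 \<rho> by (simp add: field_simps power_divide)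
  then show False using lower[of n] growth[of n] by linarith
qed

text \<open>These are the factorial moments of the binomial distribution. They express
  \<open>t ^ c\<close> exactly in the Bernstein basis, over any commutative ring and so for
  polynomials \<open>t\<close>; \<open>c = 0\<close> is the partition of unity.\<close>

lemma Bernstein_falling_factorial_identity:
  fixes t u :: "'a::comm_ring_1"
  assumes "t + u = 1" "c \<le> m"
  shows "(\<Sum>l\<le>m. of_nat (l choose c) * (of_nat (m choose l) * t ^ l * u ^ (m - l))) =
    of_nat (m choose c) * t ^ c"
proof -
  have "(\<Sum>l\<le>m. of_nat (l choose c) * (of_nat (m choose l) * t ^ l * u ^ (m - l))) =
      (\<Sum>l\<in>{c..m}. of_nat (l choose c) * (of_nat (m choose l) * t ^ l * u ^ (m - l)))"
    by (intro sum.mono_neutral_right) (auto simp: not_le binomial_eq_0)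
  also have "\<dots> = (\<Sum>i\<le>m - c. of_nat (m choose c) * t ^ c *
      (of_nat (m - c choose i) * t ^ i * u ^ (m - c - i)))"
  proof (rule sum.reindex_bij_witness[of _ "\<lambda>i. c + i" "\<lambda>l. l - c"])
    fix l assume l: "l \<in> {c..m}"
    then have "(m choose l) * (l choose c) = (m choose c) * (m - c choose (l - c))"
      by (intro choose_mult) auto
    then have eq: "of_nat (l choose c) * of_nat (m choose l) =
        (of_nat (m choose c) * of_nat (m - c choose (l - c)) :: 'a)"
      by (metis mult.commute of_nat_mult)
    have t: "t ^ l = t ^ c * t ^ (l - c)" using l by (simp flip: power_add)
    have u: "m - l = m - c - (l - c)" using l by simp
    have "of_nat (m choose c) * t ^ c *
        (of_nat (m - c choose (l - c)) * t ^ (l - c) * u ^ (m - c - (l - c))) =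
        of_nat (m choose c) * of_nat (m - c choose (l - c)) * (t ^ c * t ^ (l - c)) * u ^ (m - c - (l - c))"
      by (simp only: mult_ac)
    then show "of_nat (m choose c) * t ^ c *
        (of_nat (m - c choose (l - c)) * t ^ (l - c) * u ^ (m - c - (l - c))) =
        of_nat (l choose c) * (of_nat (m choose l) * t ^ l * u ^ (m - l))"
      unfolding eq[symmetric] t[symmetric] u[symmetric] by (simp only: mult.assoc)
  qed (use assms in auto)
  also have "\<dots> = of_nat (m choose c) * t ^ c * (t + u) ^ (m - c)"
    by (simp add: binomial_ring sum_distrib_left)
  finally show ?thesis using assms by simp
qed

text \<open>The exact Bernstein coefficient of \<open>t ^ c\<close> is compared with the value of
  the power at the node \<open>l / m\<close>, uniformly in \<open>l\<close>. Passing from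
  \<open>c\<close> to \<open>c + 1\<close> multiplies the coefficient by
  \<open>(l - c) / (m - c)\<close>, which differs from \<open>l / m\<close> by at most
  \<open>c / (m - c)\<close>.\<close>

lemma falling_factorial_power_bound:
  assumes "c < m" "l \<le> m"
  shows "\<bar>real (l choose c) / real (m choose c) - (real l / real m) ^ c\<bar> \<le> real (c * c) / real (m - c)"
  using assms(1)
proof (induction c)
  case (Suc c)
  define \<beta> where "\<beta> = real (l choose c) / real (m choose c)"
  define s where "s = real l / real m"
  have m: "m > 0" and mc: "real m - real c > 0" using Suc.prems by auto
  have choose_Suc: "real (k choose Suc c) * real (Suc c) = real (k choose c) * (real k - real c)" for k
  proof (cases "c \<le> k")
    case True
    have "(k choose Suc c) * Suc c = (k choose c) * (k - c)"
      by (metis binomial_absorb_comp binomial_absorption mult.commute)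
    then show ?thesis using True by (metis of_nat_diff of_nat_mult)
  qed (simp add: binomial_eq_0)
  have \<beta>_le: "0 \<le> \<beta>" "\<beta> \<le> 1"
    using assms(2) Suc.prems binomial_right_mono[of l m c]
    by (auto simp: \<beta>_def divide_le_eq)
  have s: "0 \<le> s" "s \<le> 1" using assms(2) m by (auto simp: s_def)
  have "real (l choose Suc c) / real (m choose Suc c) =
      (real (l choose Suc c) * real (Suc c)) / (real (m choose Suc c) * real (Suc c))"
    by simp
  also have "\<dots> = \<beta> * ((real l - real c) / (real m - real c))"
    unfolding choose_Suc \<beta>_def by simp
  finally have eq: "real (l choose Suc c) / real (m choose Suc c) - s ^ Suc c =
      \<beta> * ((real l - real c) / (real m - real c) - s) + s * (\<beta> - s ^ c)"
    by (simp add: algebra_simps)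
  have "(real l - real c) / (real m - real c) - s = - (real c * (real m - real l)) / (real m * (real m - real c))"
    using m mc by (simp add: s_def field_simps)
  then have "\<bar>(real l - real c) / (real m - real c) - s\<bar> = (real c * (real m - real l)) / (real m * (real m - real c))"
    using m mc assms(2) by (simp add: abs_mult)
  also have "\<dots> \<le> (real c * real m) / (real m * (real m - real c))"
    using m mc assms(2) by (intro divide_right_mono mult_left_mono) auto
  also have "\<dots> = real c / (real m - real c)" using m by simp
  finally have 1: "\<bar>(real l - real c) / (real m - real c) - s\<bar> \<le> real c / (real m - real c)" .
  have IH: "\<bar>\<beta> - s ^ c\<bar> \<le> real (c * c) / (real m - real c)"
    using Suc unfolding \<beta>_def s_def by (simp add: of_nat_diff)
  have "\<bar>real (l choose Suc c) / real (m choose Suc c) - s ^ Suc c\<bar> \<le>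
      \<beta> * \<bar>(real l - real c) / (real m - real c) - s\<bar> + s * \<bar>\<beta> - s ^ c\<bar>"
    unfolding eq using \<beta>_le s by (intro order_trans[OF abs_triangle_ineq]) (simp add: abs_mult)
  also have "\<dots> \<le> 1 * (real c / (real m - real c)) + 1 * (real (c * c) / (real m - real c))"
    using \<beta>_le s 1 IH by (intro add_mono mult_mono) auto
  also have "\<dots> = real (c + c * c) / (real m - real c)"
    by (simp add: add_divide_distrib)
  \<comment> \<open>The slack between \<open>c + c * c\<close> and the square of
    \<open>c + 1\<close> keeps the bound in closed form.\<close>
  also have "\<dots> \<le> real (Suc c * Suc c) / real (m - Suc c)"
    using Suc.prems by (intro frac_le) auto
  finally show ?case by (simp add: s_def)
qed simp

lemma exponent_induct:
  assumes "P 0" "\<And>\<alpha> j. P \<alpha> \<Longrightarrow> P (Poly_Mapping.single j (Suc 0) + \<alpha>)"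
  shows "P (\<alpha> :: 'n \<Rightarrow>\<^sub>0 nat)"
proof (induction \<alpha> rule: update_induct)
  case const
  show ?case by (rule assms(1))
next
  case (update f a b)
  have "P (Poly_Mapping.single a k + f)" for k
  proof (induction k)
    case (Suc k)
    have "Poly_Mapping.single a (Suc k) + f = Poly_Mapping.single a (Suc 0) + (Poly_Mapping.single a k + f)"
      by (simp flip: single_add add.assoc)
    then show ?case using assms(2)[OF Suc] by simp
  qed (simp add: update)
  moreover have "Poly_Mapping.update a b f = Poly_Mapping.single a b + f"
    using update by (intro poly_mapping_eqI)
      (auto simp: lookup_update lookup_add lookup_single in_keys_iff when_def)
  ultimately show ?case by simp
qed

lemma star_1: "star 1 = 1"
  using star_const_poly[of 1] by (simp add: const_poly_1)

lemma star_diff: "star (f - g) = star f - star g"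
  by (metis add_diff_cancel_right' diff_add_cancel star_add)

lemma star_power: "star (f ^ k) = star f ^ k"
  by (induction k) (simp_all add: star_1 star_mult)

lemma star_zbar: "star (zbar j) = zvar j"
  by (metis star_star star_zvar)

lemma const_poly_of_nat: "const_poly (of_nat n) = of_nat n"
  by (induction n) (simp_all add: const_poly_add const_poly_1, simp add: const_poly_def)

text \<open>The inequality \<open>L_square\<close> is the form in which (Q) and the positivity of
  \<open>T\<close> on \<open>M\<close> enter; \<open>q\<close> may involve both \<open>zvar\<close>
  and \<open>zbar\<close>.\<close>

locale positive_tuple = bounded_commuting_tuple E T R
  for E :: "'v::ab_group_add hilb" and T :: "'n::finite \<Rightarrow> 'v \<Rightarrow> 'v" and R +
  assumes L_square: "x \<in> hset E \<Longrightarrow> 0 \<le> Re (L x x (q * star q))"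
begin

text \<open>A good \<open>w\<close> acts as a nonnegative density for the functionals
  \<open>L x x\<close>, simultaneously for all \<open>x\<close>.\<close>

definition good :: "'n cpoly \<Rightarrow> bool"
  where "good w \<longleftrightarrow> star w = w \<and> (\<forall>x\<in>hset E. \<forall>q. 0 \<le> Re (L x x (w * (q * star q))))"

lemma good_1: "good 1"
  by (simp add: good_def star_1 L_square)

lemma good_star: "good w \<Longrightarrow> star w = w"
  by (simp add: good_def)

lemma good_scale: "good w \<Longrightarrow> 0 \<le> c \<Longrightarrow> good (w * const_poly (complex_of_real c))"
  by (simp add: good_def star_mult star_const_poly mult.assoc mult.left_commute[of w] L_const)

text \<open>This is the GNS form of a single vector with density \<open>w\<close>. Its
  Cauchy-Schwarz inequality supplies the log-convexity of moments.\<close>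

lemma good_psd_form:
  assumes w: "good w" and x: "x \<in> hset E"
  shows "psd_form UNIV plus (\<lambda>c f. const_poly c * f) (\<lambda>f g. L x x (w * (f * star g)))"
proof (unfold_locales, goal_cases)
  case (5 f g)
  have "star (w * (f * star g)) = w * (g * star f)"
    using w by (simp add: star_mult star_star good_def mult.commute)
  then show ?case using L_star[OF x x, of "w * (f * star g)"] by simp
next
  case (6 f)
  then show ?case using w x by (simp add: good_def)
qed (simp_all add: L_add distrib_right distrib_left L_const mult.assoc mult.left_commute[of w])

text \<open>Multiplication by \<open>s\<close> enlarges any bound on the sesquilinear map given by
  \<open>g\<close> by at most the factor \<open>\<rho>\<close>. Quantifying over all
  \<open>g\<close> allows iteration to powers of \<open>s\<close>; two vectors are needed because
  \<open>zvar\<close> and \<open>zbar\<close> act on different arguments.\<close>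

definition tempered :: "'n cpoly \<Rightarrow> real \<Rightarrow> bool"
  where "tempered s \<rho> \<longleftrightarrow> 0 < \<rho> \<and> star s = s \<and>
    (\<forall>g C. 0 \<le> C \<longrightarrow> (\<forall>u\<in>hset E. \<forall>v\<in>hset E. cmod (L u v g) \<le> C * nrm u * nrm v) \<longrightarrow>
      (\<forall>u\<in>hset E. \<forall>v\<in>hset E. cmod (L u v (g * s)) \<le> C * \<rho> * nrm u * nrm v))"

lemma tempered_power_bound:
  assumes s: "tempered s \<rho>" and C: "0 \<le> C"
    and g: "\<forall>u\<in>hset E. \<forall>v\<in>hset E. cmod (L u v g) \<le> C * nrm u * nrm v"
  shows "\<forall>u\<in>hset E. \<forall>v\<in>hset E. cmod (L u v (g * s ^ k)) \<le> C * \<rho> ^ k * nrm u * nrm v"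
proof (induction k)
  case (Suc k)
  have "0 \<le> C * \<rho> ^ k" using s C by (simp add: tempered_def)
  with Suc s have "\<forall>u\<in>hset E. \<forall>v\<in>hset E. cmod (L u v (g * s ^ k * s)) \<le> C * \<rho> ^ k * \<rho> * nrm u * nrm v"
    unfolding tempered_def by blast
  then show ?case by (simp add: mult_ac)
qed (use g in simp)

text \<open>A log-convex sequence of at most geometric growth already has ratio bounded by the growth
  rate. This turns the norm bounds on \<open>T\<close> into positivity of \<open>\<rho> - s\<close>, although \<open>\<rho> - s\<close> is not
  positive on all of \<open>\<complex>\<^sup>n\<close>.\<close>

lemma good_mult_diff:
  assumes w: "good w" and s: "tempered s \<rho>"
  shows "good (w * (const_poly (complex_of_real \<rho>) - s))"
  unfolding good_def
proof (intro conjI ballI allI)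
  let ?c = "const_poly (complex_of_real \<rho>) :: 'n cpoly"
  have star_s: "star s = s" and \<rho>: "\<rho> > 0" using s by (auto simp: tempered_def)
  have star_w: "star w = w" using w by (rule good_star)
  show "star (w * (?c - s)) = w * (?c - s)"
    by (simp add: star_mult star_diff star_const_poly star_s star_w)
  fix x q assume x: "x \<in> hset E"
  interpret W: psd_form UNIV plus "\<lambda>c f. const_poly c * f" "\<lambda>f g. L x x (w * (f * star g))"
    using w x by (rule good_psd_form)
  \<comment> \<open>These are the even moments of \<open>s\<close> against the density
    \<open>w * (q * star q)\<close>.\<close>
  define a where "a k = Re (L x x (w * ((q * s ^ k) * star (q * s ^ k))))" for k
  obtain C where C: "\<forall>u\<in>hset E. \<forall>v\<in>hset E. cmod (L u v (w * (q * star q))) \<le> C * nrm u * nrm v"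
    using L_bound by blast
  have C': "\<forall>u\<in>hset E. \<forall>v\<in>hset E. cmod (L u v (w * (q * star q))) \<le> max C 0 * nrm u * nrm v"
  proof (intro ballI)
    fix u v assume "u \<in> hset E" "v \<in> hset E"
    then have "C * (nrm u * nrm v) \<le> max C 0 * (nrm u * nrm v)"
      by (intro mult_right_mono) (auto simp: nrm_nonneg)
    with C \<open>u \<in> hset E\<close> \<open>v \<in> hset E\<close>
    show "cmod (L u v (w * (q * star q))) \<le> max C 0 * nrm u * nrm v" by (fastforce simp: mult.assoc)
  qed
  \<comment> \<open>The even powers grow at the rate \<open>\<rho>\<^sup>2\<close>, and the
    conclusion is nonnegativity on \<open>\<rho>\<^sup>2 - s\<^sup>2\<close>.\<close>
  have "a 1 \<le> \<rho>\<^sup>2 * a 0"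
  proof (rule log_convex_growth)
    fix k
    show "0 \<le> a k" using W.form_nonneg[of "q * s ^ k"] by (simp add: a_def)
    have "w * ((q * s ^ k) * star (q * s ^ Suc (Suc k))) = w * ((q * s ^ Suc k) * star (q * s ^ Suc k))"
      by (simp add: star_mult star_power star_s mult_ac)
    then have "(cmod (L x x (w * ((q * s ^ Suc k) * star (q * s ^ Suc k)))))\<^sup>2 \<le> a k * a (Suc (Suc k))"
      using W.Cauchy_Schwarz_square[of "q * s ^ k" "q * s ^ Suc (Suc k)"] unfolding a_def by simp
    moreover have "\<bar>a (Suc k)\<bar> \<le> cmod (L x x (w * ((q * s ^ Suc k) * star (q * s ^ Suc k))))"
      unfolding a_def by (rule abs_Re_le_cmod)
    ultimately show "(a (Suc k))\<^sup>2 \<le> a k * a (Suc (Suc k))"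
      by (metis abs_ge_zero order_trans power2_abs power_mono)
    have "w * ((q * s ^ k) * star (q * s ^ k)) = w * (q * star q) * s ^ (2 * k)"
      unfolding mult_2 power_add by (simp add: star_mult star_power star_s mult_ac)
    then have "a k \<le> cmod (L x x (w * (q * star q) * s ^ (2 * k)))"
      unfolding a_def by (simp add: complex_Re_le_cmod)
    also have "\<dots> \<le> max C 0 * \<rho> ^ (2 * k) * nrm x * nrm x"
      using tempered_power_bound[OF s _ C'] x by simp
    also have "\<dots> = (max C 0 * nrm x * nrm x) * (\<rho>\<^sup>2) ^ k" unfolding power_mult by (simp add: mult_ac)
    finally show "a k \<le> (max C 0 * nrm x * nrm x) * (\<rho>\<^sup>2) ^ k" .
  qed (use \<rho> in simp)
  \<comment> \<open>The identity behind this is \<open>2 * \<rho> * (\<rho> - s) = (\<rho> -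
    s)\<^sup>2 + (\<rho>\<^sup>2 - s\<^sup>2)\<close>, which derives the linear factor from a square
    and the moment inequality.\<close>
  moreover have "const_poly (complex_of_real (2 * \<rho>)) * (w * (?c - s) * (q * star q)) +
      w * ((q * s ^ 1) * star (q * s ^ 1)) =
      w * ((q * (?c - s)) * star (q * (?c - s))) +
      const_poly (complex_of_real (\<rho>\<^sup>2)) * (w * ((q * s ^ 0) * star (q * s ^ 0)))"
  proof -
    have c: "star ?c = ?c" by (simp add: star_const_poly)
    have "const_poly (complex_of_real (2 * \<rho>)) = ?c + ?c"
      "const_poly (complex_of_real (\<rho>\<^sup>2)) = ?c * ?c"
      by (simp_all flip: const_poly_add const_poly_mult add: power2_eq_square)
    then show ?thesis
      by (simp add: star_mult star_diff star_s c algebra_simps)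
  qed
  from arg_cong[OF this, of "\<lambda>f. Re (L x x f)"]
  have "2 * \<rho> * Re (L x x (w * (?c - s) * (q * star q))) + a 1 =
      Re (L x x (w * ((q * (?c - s)) * star (q * (?c - s))))) + \<rho>\<^sup>2 * a 0"
    unfolding L_add L_const plus_complex.sel times_complex.sel a_def by simp
  moreover have "0 \<le> Re (L x x (w * ((q * (?c - s)) * star (q * (?c - s)))))"
    using W.form_nonneg[of "q * (?c - s)"] by simp
  ultimately have "0 \<le> 2 * \<rho> * Re (L x x (w * (?c - s) * (q * star q)))" by linarith
  then show "0 \<le> Re (L x x (w * (?c - s) * (q * star q)))" using \<rho> by (simp add: zero_le_mult_iff)
qed

lemma tempered_uminus: "tempered s \<rho> \<Longrightarrow> tempered (- s) \<rho>"
proof -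
  have *: "L u v (- f) = - L u v f" for u v f
    using L_add[of u v "- f" f] by (simp add: add_eq_0_iff)
  have "star (- s) = - star s" using star_diff[of 0 s] by (simp add: star_zero)
  then show "tempered s \<rho> \<Longrightarrow> tempered (- s) \<rho>"
    by (simp add: tempered_def *)
qed

text \<open>A nice \<open>t\<close> behaves like a function with values in the unit interval, as the
  variable of Bernstein polynomials must.\<close>

definition nice :: "'n cpoly \<Rightarrow> bool"
  where "nice t \<longleftrightarrow> star t = t \<and> (\<forall>w. good w \<longrightarrow> good (w * t) \<and> good (w * (1 - t)))"

text \<open>The polynomial is the affine image of \<open>s\<close> that takes the interval from
  \<open>- \<rho>\<close> to \<open>\<rho>\<close> onto the unit interval.\<close>

lemma tempered_nice:
  assumes s: "tempered s \<rho>"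
  shows "nice (const_poly (complex_of_real (1 / (2 * \<rho>))) * (const_poly (complex_of_real \<rho>) + s))"
    (is "nice (?d * (?c + s))")
proof -
  have \<rho>: "\<rho> > 0" and star_s: "star s = s" using s by (auto simp: tempered_def)
  have "?d * ?c + ?d * ?c = 1"
    using \<rho> by (simp flip: const_poly_add const_poly_mult const_poly_1)
  then have eq: "1 - ?d * (?c + s) = ?d * (?c - s)"
    unfolding distrib_left right_diff_distrib' by (metis add_diff_cancel_left)
  have "good (w * (?d * (?c + s)))" "good (w * (?d * (?c - s)))" if w: "good w" for w
  proof -
    have "0 \<le> 1 / (2 * \<rho>)" using \<rho> by simp
    from good_scale[OF good_mult_diff[OF w s] this]
    show "good (w * (?d * (?c - s)))" by (simp only: mult_ac)
    from good_scale[OF good_mult_diff[OF w tempered_uminus[OF s]] \<open>0 \<le> 1 / (2 * \<rho>)\<close>]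
    show "good (w * (?d * (?c + s)))" by (simp only: mult_ac diff_minus_eq_add)
  qed
  moreover have "star (?d * (?c + s)) = ?d * (?c + s)"
    by (simp add: star_mult star_add star_const_poly star_s)
  ultimately show ?thesis unfolding nice_def eq by blast
qed

lemma nice_power:
  assumes t: "nice t" and w: "good w"
  shows "good (w * t ^ k)" "good (w * (1 - t) ^ k)"
proof -
  have "good (w * t ^ Suc k)" if "good (w * t ^ k)" for k
    using t that unfolding nice_def power_Suc2 mult.assoc[symmetric] by blast
  then show "good (w * t ^ k)" by (induction k) (use w in auto)
  have "good (w * (1 - t) ^ Suc k)" if "good (w * (1 - t) ^ k)" for k
    using t that unfolding nice_def power_Suc2 mult.assoc[symmetric] by blast
  then show "good (w * (1 - t) ^ k)" by (induction k) (use w in auto)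
qed

text \<open>A list of pairs \<open>(f, x)\<close> stands for the sum of the tensors of
  \<open>f\<close> with \<open>x\<close>, and append for addition. With \<open>w = 1\<close> this is
  the Bram-Halmos form.\<close>

definition form :: "'n cpoly \<Rightarrow> ('n cpoly \<times> 'v) list \<Rightarrow> ('n cpoly \<times> 'v) list \<Rightarrow> complex"
  where "form w v v' = (\<Sum>p\<leftarrow>v. \<Sum>q\<leftarrow>v'. L (snd p) (snd q) (w * (fst p * star (fst q))))"

definition lscale :: "complex \<Rightarrow> ('n cpoly \<times> 'v) list \<Rightarrow> ('n cpoly \<times> 'v) list"
  where "lscale c = map (apsnd (hscale E c))"

lemma L_scl_right:
  assumes "u \<in> hset E" "v \<in> hset E"
  shows "L u (hscale E c v) f = cnj c * L u v f"
  using assms by (induction f rule: cpoly_induct)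
    (simp_all add: L_single mp_scl form_scl_right distrib_left L_add)

lemma L_add_right:
  assumes "u \<in> hset E" "v \<in> hset E" "v' \<in> hset E"
  shows "L u (v + v') f = L u v f + L u v' f"
  using assms by (induction f rule: cpoly_induct)
    (simp_all add: L_single mp_additive form_add_right distrib_left L_add)

lemma form_Nil [simp]: "form w [] v = 0" "form w v [] = 0"
  by (simp_all add: form_def)

lemma form_append:
  "form w (u @ v) v' = form w u v' + form w v v'" "form w v' (u @ v) = form w v' u + form w v' v"
  by (simp_all add: form_def sum_list_addf)

lemma form_lscale:
  assumes "snd ` set v \<subseteq> hset E" "snd ` set v' \<subseteq> hset E"
  shows "form w (lscale c v) v' = c * form w v v'"
  using assms(1)
proof (induction v)
  case (Cons p v)
  have "(\<Sum>q\<leftarrow>v'. L (hscale E c (snd p)) (snd q) (w * (fst p * star (fst q)))) =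
      c * (\<Sum>q\<leftarrow>v'. L (snd p) (snd q) (w * (fst p * star (fst q))))"
    using assms(2) Cons.prems by (induction v') (auto simp: L_scl_left distrib_left)
  then show ?case using Cons by (simp add: form_def lscale_def distrib_left)
qed (simp add: form_def lscale_def)

lemma form_swap:
  assumes "star w = w" "snd ` set v \<subseteq> hset E" "snd ` set v' \<subseteq> hset E"
  shows "form w v' v = cnj (form w v v')"
proof -
  have "form w v' v = (\<Sum>p\<leftarrow>v. \<Sum>q\<leftarrow>v'. L (snd q) (snd p) (w * (fst q * star (fst p))))"
    unfolding form_def by (simp add: sum_list_sum_nth sum.swap[of _ "{0..<length v}"])
  also have "\<dots> = (\<Sum>p\<leftarrow>v. \<Sum>q\<leftarrow>v'. cnj (L (snd p) (snd q) (w * (fst p * star (fst q)))))"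
  proof (intro arg_cong[of _ _ sum_list] map_cong refl)
    fix p q assume "p \<in> set v" "q \<in> set v'"
    then have pq: "snd p \<in> hset E" "snd q \<in> hset E" using assms by auto
    have "w * (fst q * star (fst p)) = star (w * (fst p * star (fst q)))"
      by (simp add: star_mult star_star assms mult_ac)
    then show "L (snd q) (snd p) (w * (fst q * star (fst p))) =
        cnj (L (snd p) (snd q) (w * (fst p * star (fst q))))"
      using L_star[OF pq] by simp
  qed
  also have "\<dots> = cnj (form w v v')"
    by (simp add: form_def sum_list_sum_nth)
  finally show ?thesis .
qed

lemma form_psd_form:
  assumes w: "star w = w"
    and pos: "\<And>v. set v \<subseteq> S \<times> hset E \<Longrightarrow> 0 \<le> Re (form w v v)"
  shows "psd_form {v. set v \<subseteq> S \<times> hset E} append lscale (form w)"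
proof (unfold_locales, goal_cases)
  case (2 v c)
  then show ?case by (auto simp: lscale_def)
next
  case (4 v v' c)
  then show ?case by (intro form_lscale) auto
next
  case (5 v v')
  then show ?case by (intro form_swap w) auto
qed (auto simp: form_append pos)

end

section \<open>Complete positivity by Bernstein approximation\<close>

text \<open>The recursion over the list lets an induction remove one variable at a time.\<close>

primrec monomials_in :: "'n cpoly list \<Rightarrow> 'n cpoly set" where
  "monomials_in [] = {1}"
| "monomials_in (t # ts) = {t ^ a * g | a g. g \<in> monomials_in ts}"

lemma mult_monomials_in: "t \<in> set ts \<Longrightarrow> g \<in> monomials_in ts \<Longrightarrow> t * g \<in> monomials_in ts"
proof (induction ts arbitrary: g)
  case (Cons s ts)
  then obtain a h where g: "g = s ^ a * h" "h \<in> monomials_in ts" by auto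
  show ?case
  proof (cases "t = s")
    case True
    then have "t * g = s ^ Suc a * h" by (simp add: g mult.assoc)
    with g(2) show ?thesis unfolding monomials_in.simps by blast
  next
    case False
    with Cons g have "t * h \<in> monomials_in ts" by auto
    moreover have "t * g = s ^ a * (t * h)" by (simp add: g mult_ac)
    ultimately show ?thesis by auto
  qed
qed simp

lemma one_in_monomials: "1 \<in> monomials_in ts"
proof (induction ts)
  case (Cons t ts)
  moreover have "1 = t ^ 0 * 1" by simp
  ultimately show ?case by (simp only: monomials_in.simps) blast
qed simp

inductive_set cspan :: "'n cpoly set \<Rightarrow> 'n cpoly set" for S where
  base: "f \<in> S \<Longrightarrow> f \<in> cspan S"
| add: "f \<in> cspan S \<Longrightarrow> g \<in> cspan S \<Longrightarrow> f + g \<in> cspan S"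
| scale: "f \<in> cspan S \<Longrightarrow> const_poly c * f \<in> cspan S"

lemma mult_cspan:
  assumes f: "f \<in> cspan S" and t: "\<And>g. g \<in> S \<Longrightarrow> t * g \<in> cspan S"
  shows "t * f \<in> cspan S"
  using f
proof induction
  case (base f)
  then show ?case by (rule t)
next
  case (add f g)
  then show ?case by (simp add: distrib_left cspan.add)
next
  case (scale f c)
  from cspan.scale[OF scale.IH, of c] show ?case by (simp add: mult.left_commute)
qed

context positive_tuple
begin

lemma L_sum: "L u v (\<Sum>i\<in>I. F i) = (\<Sum>i\<in>I. L u v (F i))"
  by (induction I rule: infinite_finite_induct) (simp_all add: L_add)

lemma L_of_nat: "L u v (of_nat n * f) = of_nat n * L u v f"
  by (simp add: L_const flip: const_poly_of_nat)

lemma L_zero_left: "v \<in> hset E \<Longrightarrow> L 0 v f = 0"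
  using L_add_left[of 0 0 v f] by simp

lemma L_zero_right: "v \<in> hset E \<Longrightarrow> L v 0 f = 0"
  using L_add_right[of v 0 0 f] by simp

lemma hset_sum_list: "set xs \<subseteq> hset E \<Longrightarrow> sum_list xs \<in> hset E"
  by (induction xs) auto

text \<open>With all polynomials equal to 1, the family collapses to the sum \<open>y\<close> of its
  vectors and the form to \<open>L y y w\<close>; goodness with \<open>q = 1\<close>
  applies.\<close>

lemma form_nonneg_monomials_Nil:
  assumes w: "good w" and v: "set v \<subseteq> {1} \<times> hset E"
  shows "0 \<le> Re (form w v v)"
proof -
  have inner: "(\<Sum>q\<leftarrow>v. L y (snd q) (w * star (fst q))) = L y (sum_list (map snd v)) w"
    if "y \<in> hset E" "set v \<subseteq> {1} \<times> hset E" for y v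
    using that(2)
  proof (induction v)
    case (Cons q v)
    have "sum_list (map snd v) \<in> hset E" using Cons.prems by (intro hset_sum_list) auto
    with Cons that(1) show ?case by (auto simp: L_add_right star_1)
  qed (simp add: L_zero_right that(1))
  have sv: "sum_list (map snd v) \<in> hset E" using v by (intro hset_sum_list) auto
  have "form w u v = L (sum_list (map snd u)) (sum_list (map snd v)) w"
    if "set u \<subseteq> {1} \<times> hset E" for u
    using that
  proof (induction u)
    case (Cons p u)
    have "sum_list (map snd u) \<in> hset E" using Cons.prems by (intro hset_sum_list) auto
    with Cons sv v inner[of "snd p"] show ?case by (auto simp: form_def L_add_left)
  qed (simp add: L_zero_left sv)
  from this[OF v] show ?thesis using w sv unfolding good_def
    by (metis mult.right_neutral star_1)
qed

text \<open>With \<open>b\<^sub>l\<close> the Bernstein basis polynomials of degree \<open>m\<close> in \<open>t\<close>, the form of \<open>w\<close> is up to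
  \<open>O(1/m)\<close> the sum over \<open>l\<close> of the forms of the good weights \<open>w b\<^sub>l\<close> with \<open>t\<close> replaced by the
  scalar \<open>l/m\<close>.\<close>

lemma form_nonneg_step:
  assumes t: "nice t" and w: "good w"
    and pos: "\<And>w v. good w \<Longrightarrow> set v \<subseteq> S \<times> hset E \<Longrightarrow> 0 \<le> Re (form w v v)"
    and v: "set v \<subseteq> {t ^ a * g | a g. g \<in> S} \<times> hset E"
  shows "0 \<le> Re (form w v v)"
proof -
  define n where "n = length v"
  define x where "x i = snd (v ! i)" for i
  have "\<forall>i\<in>{0..<n}. \<exists>a g. fst (v ! i) = t ^ a * g \<and> g \<in> S"
    using v nth_mem[of _ v] unfolding n_def by fastforce
  then obtain a g where ag: "\<And>i. i \<in> {0..<n} \<Longrightarrow> fst (v ! i) = t ^ a i * g i"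
    "\<And>i. i \<in> {0..<n} \<Longrightarrow> g i \<in> S" by metis
  have x: "x i \<in> hset E" if "i \<in> {0..<n}" for i
    using subsetD[OF v nth_mem[of i v]] that unfolding n_def x_def by (auto simp: mem_Times_iff)
  have star_t: "star t = t" using t by (simp add: nice_def)
  define h where "h i j = w * (g i * star (g j))" for i j
  define D where "D i = Re (L (x i) (x i) (h i i))" for i
  define b where "b m l = of_nat (m choose l) * t ^ l * (1 - t) ^ (m - l)" for m l
  define c where "c i j = a i + a j" for i j
  have good_b: "good (w * b m l)" for m l
  proof -
    have "w * b m l = w * t ^ l * (1 - t) ^ (m - l) * const_poly (complex_of_real (real (m choose l)))"
      by (simp add: b_def const_poly_of_nat mult_ac)
    moreover have "good (w * t ^ l * (1 - t) ^ (m - l) * const_poly (complex_of_real (real (m choose l))))"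
      by (intro good_scale nice_power t w) simp
    ultimately show ?thesis by (simp only:)
  qed
  have expand: "form w v v = (\<Sum>i\<in>{0..<n}. \<Sum>j\<in>{0..<n}. L (x i) (x j) (t ^ c i j * h i j))"
    unfolding form_def sum_list_sum_nth length_map
  proof (rule sum.cong[OF n_def[symmetric, THEN arg_cong]])
    fix i assume i: "i \<in> {0..<n}"
    show "map (\<lambda>p. \<Sum>j = 0..<length v. map (\<lambda>q. L (snd p) (snd q) (w * (fst p * star (fst q)))) v ! j) v ! i =
        (\<Sum>j\<in>{0..<n}. L (x i) (x j) (t ^ c i j * h i j))"
      using i by (auto simp: n_def[symmetric] ag x_def[symmetric] star_mult star_power star_t c_def h_def
          power_add mult_ac intro!: sum.cong)
  qed
  \<comment> \<open>The Bernstein identity is exact at this point; the error arises only when the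
    coefficient is replaced by a power of \<open>l / m\<close>.\<close>
  have L_power: "L u u' (t ^ k * f) = (\<Sum>l\<le>m. complex_of_real (real (l choose k) / real (m choose k)) * L u u' (b m l * f))"
    if "k \<le> m" for u u' k m f
  proof -
    have "of_nat (m choose k) * (t ^ k * f) = (\<Sum>l\<le>m. of_nat (l choose k) * (b m l * f))"
      using Bernstein_falling_factorial_identity[of t "1 - t" k m] that
      by (simp add: b_def mult.assoc[symmetric] sum_distrib_right flip: sum_distrib_right)
    from arg_cong[OF this, of "L u u'"]
    have "of_nat (m choose k) * L u u' (t ^ k * f) = (\<Sum>l\<le>m. of_nat (l choose k) * L u u' (b m l * f))"
      by (simp only: L_of_nat L_sum)
    moreover have "(of_nat (m choose k) :: complex) \<noteq> 0" using that by (simp add: binomial_eq_0_iff)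
    ultimately have "L u u' (t ^ k * f) = (\<Sum>l\<le>m. of_nat (l choose k) * L u u' (b m l * f)) / of_nat (m choose k)"
      by (simp add: field_simps)
    then show ?thesis by (simp add: sum_divide_distrib)
  qed
  \<comment> \<open>The total mass of the off-diagonal terms is bounded uniformly in
    \<open>m\<close>. Cauchy-Schwarz for the weight \<open>w * b m l\<close> and the arithmetic mean
    reduce it to diagonal terms, which sum to \<open>D\<close> because the \<open>b m l\<close> form
    a partition of unity.\<close>
  have abs_sum: "(\<Sum>l\<le>m. cmod (L (x i) (x j) (b m l * h i j))) \<le> (D i + D j) / 2"
    if ij: "i \<in> {0..<n}" "j \<in> {0..<n}" for i j m
  proof -
    have "cmod (L (x i) (x j) (b m l * h i j)) \<le>
        (Re (L (x i) (x i) (b m l * h i i)) + Re (L (x j) (x j) (b m l * h j j))) / 2" for l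
    proof -
      interpret W: psd_form "{v. set v \<subseteq> S \<times> hset E}" append lscale "form (w * b m l)"
        by (intro form_psd_form good_star pos good_b)
      have in': "[(g i, x i)] \<in> {v. set v \<subseteq> S \<times> hset E}" "[(g j, x j)] \<in> {v. set v \<subseteq> S \<times> hset E}"
        using ag x ij by auto
      have eq: "form (w * b m l) [(g p, x p)] [(g q, x q)] = L (x p) (x q) (b m l * h p q)" for p q
        by (simp add: form_def h_def mult_ac)
      let ?p = "W.nrm [(g i, x i)]" and ?q = "W.nrm [(g j, x j)]"
      have "0 \<le> (?p - ?q)\<^sup>2" by simp
      then have "?p * ?q \<le> (?p\<^sup>2 + ?q\<^sup>2) / 2" by (simp add: power2_diff)
      then show ?thesis
        using W.Cauchy_Schwarz[OF in'] unfolding W.nrm_square[OF in'(1)] W.nrm_square[OF in'(2)] eq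
        by linarith
    qed
    then have "(\<Sum>l\<le>m. cmod (L (x i) (x j) (b m l * h i j))) \<le>
        (\<Sum>l\<le>m. (Re (L (x i) (x i) (b m l * h i i)) + Re (L (x j) (x j) (b m l * h j j))) / 2)"
      by (intro sum_mono)
    also have "\<dots> = (Re (\<Sum>l\<le>m. L (x i) (x i) (b m l * h i i)) + Re (\<Sum>l\<le>m. L (x j) (x j) (b m l * h j j))) / 2"
      by (simp add: sum.distrib Re_sum flip: sum_divide_distrib)
    also have "\<dots> = (D i + D j) / 2"
      using L_power[of 0 m "x i" "x i" "h i i"] L_power[of 0 m "x j" "x j" "h j j"] by (simp add: D_def)
    finally show ?thesis .
  qed
  define e where "e m i j = real (c i j * c i j) / real (m - c i j) * ((D i + D j) / 2)" for m i j
  have lower: "- (\<Sum>i\<in>{0..<n}. \<Sum>j\<in>{0..<n}. e m i j) \<le> Re (form w v v)"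
    if m: "\<And>i j. i \<in> {0..<n} \<Longrightarrow> j \<in> {0..<n} \<Longrightarrow> c i j < m" for m
  proof -
    define s where "s l = real l / real m" for l
    define M where "M l i j = L (x i) (x j) (b m l * h i j)" for l i j
    define \<beta> where "\<beta> l i j = real (l choose c i j) / real (m choose c i j)" for l i j
    \<comment> \<open>With \<open>t\<close> replaced by the number \<open>s l\<close>, its powers
      are absorbed into the vectors. What remains is a family over \<open>S\<close> with the good
      weight \<open>w * b m l\<close>.\<close>
    have main: "0 \<le> Re (\<Sum>i\<in>{0..<n}. \<Sum>j\<in>{0..<n}. complex_of_real (s l ^ c i j) * M l i j)" for l
    proof -
      define u where "u = map (\<lambda>i. (g i, hscale E (complex_of_real (s l ^ a i)) (x i))) [0..<n]"
      have "set u \<subseteq> S \<times> hset E" using ag x by (auto simp: u_def)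
      then have "0 \<le> Re (form (w * b m l) u u)" by (intro pos good_b)
      also have "form (w * b m l) u u = (\<Sum>i\<in>{0..<n}. \<Sum>j\<in>{0..<n}.
          L (hscale E (complex_of_real (s l ^ a i)) (x i)) (hscale E (complex_of_real (s l ^ a j)) (x j))
            ((w * b m l) * (g i * star (g j))))"
        by (simp add: form_def u_def sum_list_sum_nth)
      also have "\<dots> = (\<Sum>i\<in>{0..<n}. \<Sum>j\<in>{0..<n}. complex_of_real (s l ^ c i j) * M l i j)"
        using x by (intro sum.cong refl)
          (simp add: L_scl_left L_scl_right M_def h_def c_def power_add mult_ac)
      finally show ?thesis .
    qed
    have error: "cmod (\<Sum>l\<le>m. complex_of_real (\<beta> l i j - s l ^ c i j) * M l i j) \<le> e m i j"
      if ij: "i \<in> {0..<n}" "j \<in> {0..<n}" for i j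
    proof -
      let ?\<delta> = "real (c i j * c i j) / real (m - c i j)"
      have "cmod (\<Sum>l\<le>m. complex_of_real (\<beta> l i j - s l ^ c i j) * M l i j) \<le> (\<Sum>l\<le>m. ?\<delta> * cmod (M l i j))"
      proof (rule sum_norm_le)
        fix l assume "l \<in> {..m}"
        then have "\<bar>\<beta> l i j - s l ^ c i j\<bar> \<le> ?\<delta>"
          unfolding \<beta>_def s_def using m[OF ij] by (intro falling_factorial_power_bound) auto
        then show "cmod (complex_of_real (\<beta> l i j - s l ^ c i j) * M l i j) \<le> ?\<delta> * cmod (M l i j)"
          unfolding norm_mult norm_of_real by (intro mult_right_mono) auto
      qed
      also have "\<dots> = ?\<delta> * (\<Sum>l\<le>m. cmod (M l i j))" by (simp only: sum_distrib_left)
      also have "\<dots> \<le> e m i j"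
        unfolding e_def M_def using abs_sum[OF ij, of m] by (intro mult_left_mono) auto
      finally show ?thesis .
    qed
    have "form w v v = (\<Sum>i\<in>{0..<n}. \<Sum>j\<in>{0..<n}. \<Sum>l\<le>m. complex_of_real (\<beta> l i j) * M l i j)"
      unfolding expand \<beta>_def M_def using m by (intro sum.cong refl L_power) (auto intro: less_imp_le)
    also have "\<dots> = (\<Sum>i\<in>{0..<n}. \<Sum>j\<in>{0..<n}. (\<Sum>l\<le>m. complex_of_real (s l ^ c i j) * M l i j) +
        (\<Sum>l\<le>m. complex_of_real (\<beta> l i j - s l ^ c i j) * M l i j))"
      by (intro sum.cong refl) (simp add: left_diff_distrib sum_subtractf)
    also have "\<dots> = (\<Sum>l\<le>m. \<Sum>i\<in>{0..<n}. \<Sum>j\<in>{0..<n}. complex_of_real (s l ^ c i j) * M l i j) +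
        (\<Sum>i\<in>{0..<n}. \<Sum>j\<in>{0..<n}. \<Sum>l\<le>m. complex_of_real (\<beta> l i j - s l ^ c i j) * M l i j)"
      by (simp add: sum.distrib sum.swap[of _ "{..m}"])
    finally have eq: "Re (form w v v) =
        (\<Sum>l\<le>m. Re (\<Sum>i\<in>{0..<n}. \<Sum>j\<in>{0..<n}. complex_of_real (s l ^ c i j) * M l i j)) +
        (\<Sum>i\<in>{0..<n}. \<Sum>j\<in>{0..<n}. Re (\<Sum>l\<le>m. complex_of_real (\<beta> l i j - s l ^ c i j) * M l i j))"
      by (simp only: plus_complex.sel Re_sum)
    have "- (\<Sum>i\<in>{0..<n}. \<Sum>j\<in>{0..<n}. e m i j) \<le>
        (\<Sum>i\<in>{0..<n}. \<Sum>j\<in>{0..<n}. Re (\<Sum>l\<le>m. complex_of_real (\<beta> l i j - s l ^ c i j) * M l i j))"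
      unfolding sum_negf[symmetric]
    proof (intro sum_mono)
      fix i j assume "i \<in> {0..<n}" "j \<in> {0..<n}"
      from error[OF this] abs_Re_le_cmod[of "\<Sum>l\<le>m. complex_of_real (\<beta> l i j - s l ^ c i j) * M l i j"]
      show "- e m i j \<le> Re (\<Sum>l\<le>m. complex_of_real (\<beta> l i j - s l ^ c i j) * M l i j)" by linarith
    qed
    moreover have "0 \<le> (\<Sum>l\<le>m. Re (\<Sum>i\<in>{0..<n}. \<Sum>j\<in>{0..<n}. complex_of_real (s l ^ c i j) * M l i j))"
      by (intro sum_nonneg main)
    ultimately show ?thesis unfolding eq by linarith
  qed
  have "(\<lambda>m. e m i j) \<longlonglongrightarrow> 0" for i j
  proof -
    have "(\<lambda>m. real (c i j * c i j) / real m) \<longlonglongrightarrow> 0" by (rule lim_const_over_n)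
    then have "(\<lambda>m. real (c i j * c i j) / real (m + c i j - c i j)) \<longlonglongrightarrow> 0" by simp
    then have "(\<lambda>m. real (c i j * c i j) / real (m - c i j)) \<longlonglongrightarrow> 0" by (rule LIMSEQ_offset)
    then show ?thesis unfolding e_def by (rule tendsto_mult_left_zero)
  qed
  then have "(\<lambda>m. - (\<Sum>i\<in>{0..<n}. \<Sum>j\<in>{0..<n}. e m i j)) \<longlonglongrightarrow> - (\<Sum>i\<in>{0..<n}. \<Sum>j\<in>{0..<n}. 0)"
    by (intro tendsto_minus tendsto_sum)
  moreover have "\<exists>N. \<forall>m\<ge>N. - (\<Sum>i\<in>{0..<n}. \<Sum>j\<in>{0..<n}. e m i j) \<le> Re (form w v v)"
  \<comment> \<open>The sum of all \<open>c i j\<close> dominates each of them, so the denominators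
    \<open>m - c i j\<close> are positive from here on.\<close>
  proof (intro exI[of _ "Suc (\<Sum>i\<in>{0..<n}. \<Sum>j\<in>{0..<n}. c i j)"] allI impI lower)
    fix m i j assume m: "Suc (\<Sum>i\<in>{0..<n}. \<Sum>j\<in>{0..<n}. c i j) \<le> m" and ij: "i \<in> {0..<n}" "j \<in> {0..<n}"
    have "c i j \<le> (\<Sum>j\<in>{0..<n}. c i j)" using ij by (intro member_le_sum) auto
    also have "\<dots> \<le> (\<Sum>i\<in>{0..<n}. \<Sum>j\<in>{0..<n}. c i j)"
      using ij by (intro member_le_sum[of i _ "\<lambda>i. \<Sum>j\<in>{0..<n}. c i j"]) auto
    finally show "c i j < m" using m by simp
  qed
  ultimately show ?thesis by (intro LIMSEQ_le_const2[where X = "\<lambda>m. - (\<Sum>i\<in>{0..<n}. \<Sum>j\<in>{0..<n}. e m i j)"]) simp_all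
qed

text \<open>The weight has to vary in the induction, since removing a variable creates the new
  weights \<open>w * b m l\<close>.\<close>

lemma form_nonneg_monomials:
  assumes "\<forall>t\<in>set ts. nice t" "good w" "set v \<subseteq> monomials_in ts \<times> hset E"
  shows "0 \<le> Re (form w v v)"
  using assms
proof (induction ts arbitrary: w v)
  case Nil
  then show ?case by (intro form_nonneg_monomials_Nil) auto
next
  case (Cons t ts)
  show ?case
  proof (rule form_nonneg_step)
    show "nice t" "good w" "set v \<subseteq> {t ^ a * g | a g. g \<in> monomials_in ts} \<times> hset E"
      using Cons.prems by auto
  qed (use Cons in auto)
qed

text \<open>Scalars are shifted from the polynomial to the vector, which turns a combination of
  elements of \<open>S\<close> into a list over \<open>S\<close> with the same pairings.\<close>

lemma cspan_list:
  assumes "f \<in> cspan S" "x \<in> hset E"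
  shows "\<exists>v. set v \<subseteq> S \<times> hset E \<and> (\<forall>w u. snd ` set u \<subseteq> hset E \<longrightarrow> form w [(f, x)] u = form w v u)"
  using assms
proof (induction arbitrary: x)
  case (base f)
  then show ?case by (intro exI[of _ "[(f, x)]"]) auto
next
  case (add f g)
  obtain v1 where v1: "set v1 \<subseteq> S \<times> hset E"
    "\<forall>w u. snd ` set u \<subseteq> hset E \<longrightarrow> form w [(f, x)] u = form w v1 u" using add by blast
  obtain v2 where v2: "set v2 \<subseteq> S \<times> hset E"
    "\<forall>w u. snd ` set u \<subseteq> hset E \<longrightarrow> form w [(g, x)] u = form w v2 u" using add by blast
  have "form w [(f + g, x)] u = form w [(f, x)] u + form w [(g, x)] u" for w u
    by (simp add: form_def distrib_left distrib_right L_add sum_list_addf)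
  with v1 v2 show ?case by (intro exI[of _ "v1 @ v2"]) (simp add: form_append)
next
  case (scale f c)
  obtain v where v: "set v \<subseteq> S \<times> hset E"
    "\<forall>w u. snd ` set u \<subseteq> hset E \<longrightarrow> form w [(f, hscale E c x)] u = form w v u"
    using scale.IH[of "hscale E c x"] scale.prems by auto
  have "form w [(const_poly c * f, x)] u = form w [(f, hscale E c x)] u"
    if u: "snd ` set u \<subseteq> hset E" for w u
  proof -
    have "form w [(f, hscale E c x)] u = form w (lscale c [(f, x)]) u" by (simp add: lscale_def)
    also have "\<dots> = c * form w [(f, x)] u" using u scale.prems by (intro form_lscale) auto
    also have "\<dots> = form w [(const_poly c * f, x)] u"
      by (simp add: form_def mult.left_commute[of w] mult.assoc L_const sum_list_const_mult)
    finally show ?thesis ..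
  qed
  with v show ?case by auto
qed

lemma form_nonneg_cspan:
  assumes w: "good w" and pos: "\<And>v. set v \<subseteq> S \<times> hset E \<Longrightarrow> 0 \<le> Re (form w v v)"
    and v: "set v \<subseteq> cspan S \<times> hset E"
  shows "0 \<le> Re (form w v v)"
proof -
  have "\<exists>v'. set v' \<subseteq> S \<times> hset E \<and> (\<forall>u. snd ` set u \<subseteq> hset E \<longrightarrow> form w v u = form w v' u)"
    using v
  proof (induction v)
    case (Cons p v)
    then obtain v1 where v1: "set v1 \<subseteq> S \<times> hset E"
      "\<forall>u. snd ` set u \<subseteq> hset E \<longrightarrow> form w v u = form w v1 u" by auto
    obtain v2 where v2: "set v2 \<subseteq> S \<times> hset E"
      "\<forall>w u. snd ` set u \<subseteq> hset E \<longrightarrow> form w [p] u = form w v2 u"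
      using cspan_list[of "fst p" S "snd p"] Cons.prems by auto
    have "form w (p # v) u = form w [p] u + form w v u" for u
      using form_append(1)[of w "[p]" v u] by simp
    with v1 v2 show ?case by (intro exI[of _ "v2 @ v1"]) (simp add: form_append)
  qed (intro exI[of _ "[]"], simp)
  then obtain v' where v': "set v' \<subseteq> S \<times> hset E"
    "\<And>u. snd ` set u \<subseteq> hset E \<Longrightarrow> form w v u = form w v' u" by blast
  have in': "snd ` set v \<subseteq> hset E" "snd ` set v' \<subseteq> hset E" using v v' by auto
  \<comment> \<open>The replacement acts on the first argument; symmetry gives access to the
    second.\<close>
  have "form w v v = form w v' v" using v'(2) in' by blast
  also have "\<dots> = cnj (form w v v')" using good_star[OF w] in' by (intro form_swap)
  also have "form w v v' = form w v' v'" using v'(2) in' by blast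
  finally show ?thesis using pos[OF v'(1)] by simp
qed

end

section \<open>The normal extension\<close>

context positive_tuple
begin

lemma L_uminus: "L u v (- f) = - L u v f"
  using L_add[of u v "- f" f] by (simp add: add_eq_0_iff)

lemma L_diff: "L u v (f - g) = L u v f - L u v g"
  using L_add[of u v f "- g"] by (simp add: L_uminus)

lemma L_T_bound:
  assumes C: "0 \<le> C" "\<forall>u\<in>hset E. \<forall>v\<in>hset E. cmod (L u v g) \<le> C * nrm u * nrm v"
    and uv: "u \<in> hset E" "v \<in> hset E"
  shows "cmod (L (T j u) v g) \<le> C * R * nrm u * nrm v" "cmod (L u (T j v) g) \<le> C * R * nrm u * nrm v"
proof -
  have "cmod (L (T j u) v g) \<le> C * nrm (T j u) * nrm v" using C uv by simp
  also have "\<dots> \<le> C * (R * nrm u) * nrm v"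
    using C uv by (intro mult_right_mono mult_left_mono T_bound) (auto simp: nrm_nonneg)
  finally show "cmod (L (T j u) v g) \<le> C * R * nrm u * nrm v" by (simp add: mult_ac)
  have "cmod (L u (T j v) g) \<le> C * nrm u * nrm (T j v)" using C uv by simp
  also have "\<dots> \<le> C * nrm u * (R * nrm v)"
    using C uv by (intro mult_left_mono T_bound) (auto simp: nrm_nonneg)
  finally show "cmod (L u (T j v) g) \<le> C * R * nrm u * nrm v" by (simp add: mult_ac)
qed

definition re_var :: "'n \<Rightarrow> 'n cpoly"
  where "re_var j = const_poly (1 / 2) * (zvar j + zbar j)"

definition im_var :: "'n \<Rightarrow> 'n cpoly"
  where "im_var j = const_poly (- \<i> / 2) * (zvar j - zbar j)"

lemma zvar_eq: "zvar j = re_var j + const_poly \<i> * im_var j" (is ?z)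
  and zbar_eq: "zbar j = re_var j + const_poly (- \<i>) * im_var j" (is ?zb)
proof -
  define c :: "'n cpoly" where "c = const_poly (1 / 2)"
  have c: "c + c = 1" by (simp add: c_def flip: const_poly_add const_poly_1)
  have *: "const_poly \<i> * im_var j = c * (zvar j - zbar j)"
    "const_poly (- \<i>) * im_var j = const_poly (-1) * (c * (zvar j - zbar j))"
    by (simp_all add: im_var_def c_def mult.assoc[symmetric] flip: const_poly_mult)
  have m: "const_poly (-1) * f = - f" for f :: "'n cpoly"
  proof -
    have "const_poly (-1) * f + f = (const_poly (-1) + const_poly 1) * f"
      by (simp add: distrib_right const_poly_1)
    also have "\<dots> = 0" unfolding const_poly_add[symmetric] by (simp add: const_poly_def)
    finally show ?thesis by (simp add: add_eq_0_iff2)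
  qed
  have "re_var j + const_poly \<i> * im_var j = (c + c) * zvar j"
    unfolding * re_var_def c_def[symmetric] by (simp add: algebra_simps)
  then show ?z by (simp add: c)
  have "re_var j + const_poly (- \<i>) * im_var j = (c + c) * zbar j"
    unfolding * m re_var_def c_def[symmetric] by (simp add: algebra_simps)
  then show ?zb by (simp add: c)
qed

text \<open>Multiplication by the real part averages the action of \<open>T j\<close> on the two
  vectors, so the bound \<open>R\<close> survives without a factor 2.\<close>

lemma tempered_re_var: "tempered (re_var j) R"
  unfolding tempered_def
proof (intro conjI allI impI ballI R_pos)
  show "star (re_var j) = re_var j"
    by (simp add: re_var_def star_mult star_const_poly star_add star_zvar star_zbar add.commute)
  fix g C u v
  assume C: "0 \<le> C" "\<forall>u\<in>hset E. \<forall>v\<in>hset E. cmod (L u v g) \<le> C * nrm u * nrm v"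
    and uv: "u \<in> hset E" "v \<in> hset E"
  have "L u v (g * re_var j) = 1 / 2 * (L (T j u) v g + L u (T j v) g)"
    unfolding re_var_def mult.left_commute[of g] L_const
    using uv by (simp add: distrib_left L_add L_zvar L_zbar)
  also have "cmod \<dots> = 1 / 2 * cmod (L (T j u) v g + L u (T j v) g)" by (simp add: norm_mult)
  also have "\<dots> \<le> C * R * nrm u * nrm v"
    using norm_triangle_ineq[of "L (T j u) v g" "L u (T j v) g"] L_T_bound[OF C uv, of j] by simp
  finally show "cmod (L u v (g * re_var j)) \<le> C * R * nrm u * nrm v" .
qed

lemma tempered_im_var: "tempered (im_var j) R"
  unfolding tempered_def
proof (intro conjI allI impI ballI R_pos)
  have "const_poly (\<i> / 2) * (zbar j - zvar j) = const_poly (- \<i> / 2) * (zvar j - zbar j)"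
  proof -
    have "const_poly (\<i> / 2) + const_poly (- \<i> / 2) = (0 :: 'n cpoly)"
      unfolding const_poly_add[symmetric] by (simp add: const_poly_def)
    then have "const_poly (\<i> / 2) = - (const_poly (- \<i> / 2) :: 'n cpoly)" by (simp add: add_eq_0_iff2)
    then show ?thesis by (simp add: algebra_simps)
  qed
  then show "star (im_var j) = im_var j"
    by (simp add: im_var_def star_mult star_const_poly star_diff star_zvar star_zbar)
  fix g C u v
  assume C: "0 \<le> C" "\<forall>u\<in>hset E. \<forall>v\<in>hset E. cmod (L u v g) \<le> C * nrm u * nrm v"
    and uv: "u \<in> hset E" "v \<in> hset E"
  have "L u v (g * im_var j) = (- \<i> / 2) * (L (T j u) v g - L u (T j v) g)"
    unfolding im_var_def mult.left_commute[of g] L_const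
    using uv by (simp add: right_diff_distrib L_diff L_zvar L_zbar)
  also have "cmod \<dots> = 1 / 2 * cmod (L (T j u) v g - L u (T j v) g)" by (simp add: norm_mult)
  also have "\<dots> \<le> C * R * nrm u * nrm v"
    using norm_triangle_ineq4[of "L (T j u) v g" "L u (T j v) g"] L_T_bound[OF C uv, of j] by simp
  finally show "cmod (L u v (g * im_var j)) \<le> C * R * nrm u * nrm v" .
qed

lemma tempered_zvar_zbar: "tempered (zvar j * zbar j) (R\<^sup>2)"
  unfolding tempered_def
proof (intro conjI allI impI ballI)
  show "0 < R\<^sup>2" using R_pos by simp
  show "star (zvar j * zbar j) = zvar j * zbar j"
    by (simp add: star_mult star_zvar star_zbar mult.commute)
  fix g C u v
  assume C: "0 \<le> C" "\<forall>u\<in>hset E. \<forall>v\<in>hset E. cmod (L u v g) \<le> C * nrm u * nrm v"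
    and uv: "u \<in> hset E" "v \<in> hset E"
  have "cmod (L u v (g * (zvar j * zbar j))) = cmod (L (T j u) (T j v) g)"
    using uv by (simp add: L_zvar L_zbar flip: mult.assoc)
  also have "\<dots> \<le> C * R * nrm u * nrm (T j v)" using uv by (intro L_T_bound(1)[OF C]) auto
  also have "\<dots> \<le> C * R * nrm u * (R * nrm v)"
    using C uv R_pos by (intro mult_left_mono T_bound mult_nonneg_nonneg nrm_nonneg) auto
  finally show "cmod (L u v (g * (zvar j * zbar j))) \<le> C * R\<^sup>2 * nrm u * nrm v"
    by (simp add: power2_eq_square mult_ac)
qed

text \<open>The \<open>2n\<close> real coordinates, rescaled from the cube with half-side
  \<open>R\<close> to the unit cube.\<close>

definition unit_vars :: "'n cpoly list"
  where "unit_vars =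
    map (\<lambda>s. const_poly (complex_of_real (1 / (2 * R))) * (const_poly (complex_of_real R) + s))
      (map re_var enumeration @ map im_var enumeration)"

lemma nice_unit_vars: "\<forall>t\<in>set unit_vars. nice t"
  unfolding unit_vars_def
  using tempered_nice[OF tempered_re_var] tempered_nice[OF tempered_im_var] by auto

lemma mult_var_cspan:
  assumes f: "f \<in> cspan (monomials_in unit_vars)"
  shows "zvar j * f \<in> cspan (monomials_in unit_vars)" "zbar j * f \<in> cspan (monomials_in unit_vars)"
proof -
  have var: "s * f \<in> cspan (monomials_in unit_vars)" if s: "s \<in> {re_var j, im_var j}" for s
  proof -
    define t where "t = const_poly (complex_of_real (1 / (2 * R))) * (const_poly (complex_of_real R) + s)"
    have t: "t \<in> set unit_vars" using s unfolding t_def unit_vars_def by (auto simp: enumeration)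
    have "t * f \<in> cspan (monomials_in unit_vars)"
      using f by (rule mult_cspan) (auto intro!: cspan.base mult_monomials_in t)
    \<comment> \<open>The rescaling is inverted: \<open>s = 2 * R * t - R\<close>.\<close>
    then have "const_poly (complex_of_real (2 * R)) * (t * f) + const_poly (complex_of_real (- R)) * f
        \<in> cspan (monomials_in unit_vars)"
      by (intro cspan.add cspan.scale f)
    also have "const_poly (complex_of_real (2 * R)) * (t * f) + const_poly (complex_of_real (- R)) * f =
        (const_poly (complex_of_real (2 * R)) * const_poly (complex_of_real (1 / (2 * R)))) *
          (const_poly (complex_of_real R) + s) * f + const_poly (complex_of_real (- R)) * f"
      by (simp only: t_def mult.assoc)
    also have "\<dots> = (const_poly (complex_of_real R) + const_poly (complex_of_real (- R))) * f + s * f"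
      unfolding const_poly_mult[symmetric] using R_pos by (simp add: const_poly_1 algebra_simps)
    also have "\<dots> = s * f"
      unfolding const_poly_add[symmetric] by (simp add: const_poly_def)
    finally show ?thesis .
  qed
  show "zvar j * f \<in> cspan (monomials_in unit_vars)" "zbar j * f \<in> cspan (monomials_in unit_vars)"
    unfolding zvar_eq zbar_eq distrib_right mult.assoc
    by (intro cspan.add cspan.scale var; simp)+
qed

lemma cspan_unit_vars: "f \<in> cspan (monomials_in unit_vars)"
proof -
  let ?C = "cspan (monomials_in unit_vars)"
  have one: "1 \<in> ?C" by (intro cspan.base one_in_monomials)
  have "Poly_Mapping.single (0, \<beta>) 1 \<in> ?C" for \<beta>
  proof (induction \<beta> rule: exponent_induct)
    case (2 \<beta> j)
    from mult_var_cspan(2)[OF 2, of j] show ?case by (simp add: zbar_def mult_single)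
  qed (use one in \<open>simp flip: zero_prod_def\<close>)
  then have mon: "Poly_Mapping.single (\<alpha>, \<beta>) 1 \<in> ?C" for \<alpha> \<beta>
  proof (induction \<alpha> rule: exponent_induct)
    case (2 \<alpha> j)
    from mult_var_cspan(1)[OF 2(1)[OF 2(2)], of j] show ?case by (simp add: zvar_def mult_single)
  qed
  show ?thesis
  proof (induction f rule: cpoly_induct)
    case 1
    from cspan.scale[OF one, of 0] show ?case by (simp add: const_poly_def)
  next
    case (2 m c)
    from cspan.scale[OF mon[of "fst m" "snd m"], of c] show ?case
      by (simp add: const_poly_def mult_single)
  qed (rule cspan.add)
qed

text \<open>The weight 1 yields the inner product of the extension, and the weight
  \<open>R\<^sup>2 - zvar j * zbar j\<close> the boundedness of its operators.\<close>

theorem form_nonneg_good: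
  assumes "good w" "snd ` set v \<subseteq> hset E"
  shows "0 \<le> Re (form w v v)"
proof (rule form_nonneg_cspan[OF assms(1)])
  show "set v \<subseteq> cspan (monomials_in unit_vars) \<times> hset E"
    using assms(2) by (auto simp: cspan_unit_vars)
qed (use assms(1) in \<open>rule form_nonneg_monomials[OF nice_unit_vars]\<close>)

text \<open>Coefficients are left to the vectors. The resulting set is countable and closed under
  multiplication by variables, so a countable dense family can be stable under the multiplication
  operators.\<close>

definition monomials :: "'n cpoly set"
  where "monomials = range (\<lambda>m. Poly_Mapping.single m 1)"

lemma one_monomials: "1 \<in> monomials"
  unfolding monomials_def single_one[symmetric] by (rule rangeI)

lemma mult_monomials_var: "f \<in> monomials \<Longrightarrow> f * zvar j \<in> monomials" "f \<in> monomials \<Longrightarrow> f * zbar j \<in> monomials"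
  by (auto simp: monomials_def zvar_def zbar_def mult_single)

lemma countable_monomials: "countable monomials"
proof -
  have "countable (UNIV :: ('n \<Rightarrow>\<^sub>0 nat) set)"
    by (rule countable_image_inj_on[of Poly_Mapping.lookup])
      (auto simp: inj_on_def intro: countableI_type)
  from countable_SIGMA[OF this this] have "countable (UNIV :: 'n mon set)" by simp
  then show ?thesis unfolding monomials_def by (rule countable_image)
qed

abbreviation vectors :: "('n cpoly \<times> 'v) list set"
  where "vectors \<equiv> {v. set v \<subseteq> monomials \<times> hset E}"

sublocale W: psd_form vectors append lscale "form 1"
  by (intro form_psd_form star_1 form_nonneg_good good_1) auto

lemma W_dense:
  assumes D: "D \<subseteq> hset E" "\<forall>x\<in>hset E. \<forall>e>0. \<exists>y\<in>D. hnorm E (x - y) < e"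
    and v: "v \<in> vectors" and e: "e > 0"
  shows "\<exists>v'. set v' \<subseteq> monomials \<times> D \<and> W.nrm (W.diff v v') < e"
  using v e
proof (induction v arbitrary: e)
  case Nil
  have "W.diff [] [] = []" unfolding W.diff_def lscale_def by simp
  then show ?case using Nil by (intro exI[of _ "[]"]) (simp add: W.nrm_def)
next
  case (Cons p v)
  obtain f x where p: "p = (f, x)" by (cases p)
  have f: "f \<in> monomials" and x: "x \<in> hset E" and v: "v \<in> vectors" using Cons.prems p by auto
  obtain v' where v': "set v' \<subseteq> monomials \<times> D" "W.nrm (W.diff v v') < e / 2"
    using Cons.IH[OF v, of "e / 2"] Cons.prems by auto
  obtain K where K: "\<forall>u\<in>hset E. \<forall>v\<in>hset E. cmod (L u v (f * star f)) \<le> K * nrm u * nrm v"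
    using L_bound by blast
  \<comment> \<open>Chosen so that \<open>(\<bar>K\<bar> + 1) * \<delta>\<^sup>2\<close> is at most
    \<open>(e / 2)\<^sup>2\<close>; the added 1 also covers \<open>K = 0\<close>.\<close>
  define \<delta> where "\<delta> = e / (2 * (\<bar>K\<bar> + 1))"
  have \<delta>: "\<delta> > 0" using Cons.prems by (simp add: \<delta>_def)
  obtain y where y: "y \<in> D" "nrm (x - y) < \<delta>" using D(2) x \<delta> unfolding nrm_eq by blast
  have yE: "y \<in> hset E" using y D by auto
  have in': "[(f, x)] \<in> vectors" "[(f, y)] \<in> vectors" "v' \<in> vectors"
    using f x yE v' D by auto
  have "W.nrm (W.diff [(f, x)] [(f, y)]) \<le> e / 2"
  proof (rule power2_le_imp_le)
    have form1: "form 1 [(f, a)] [(f, b)] = L a b (f * star f)" for a b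
      by (simp add: form_def)
    have L_diff_left: "L (a - b) c g = L a c g - L b c g" if "a \<in> hset E" "b \<in> hset E" "c \<in> hset E" for a b c g
      using L_add_left[of "a - b" b c g] that by simp
    have L_diff_right: "L c (a - b) g = L c a g - L c b g" if "a \<in> hset E" "b \<in> hset E" "c \<in> hset E" for a b c g
      using L_add_right[of c "a - b" b g] that by simp
    have "form 1 (W.diff [(f, x)] [(f, y)]) (W.diff [(f, x)] [(f, y)]) = L (x - y) (x - y) (f * star f)"
      using in' x yE
      by (simp only: W.form_diff_left W.form_diff_right W.diff_closed form1 L_diff_left L_diff_right hdiff_closed)
    then have "(W.nrm (W.diff [(f, x)] [(f, y)]))\<^sup>2 = Re (L (x - y) (x - y) (f * star f))"
      using W.nrm_square[OF W.diff_closed[OF in'(1,2)]] by simp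
    also have "\<dots> \<le> K * nrm (x - y) * nrm (x - y)"
      using K hdiff_closed[OF x yE] by (blast intro: order_trans[OF complex_Re_le_cmod])
    also have "\<dots> \<le> (\<bar>K\<bar> + 1) * (nrm (x - y))\<^sup>2"
      unfolding power2_eq_square mult.assoc by (intro mult_right_mono) auto
    also have "\<dots> \<le> (\<bar>K\<bar> + 1) * \<delta>\<^sup>2"
      using y x yE by (intro mult_left_mono power_mono) (auto simp: nrm_nonneg)
    also have "\<dots> = e\<^sup>2 / (4 * (\<bar>K\<bar> + 1))"
    proof -
      define k where "k = \<bar>K\<bar> + 1"
      have "k > 0" by (simp add: k_def)
      then show ?thesis unfolding \<delta>_def k_def[symmetric] by (simp add: power2_eq_square)
    qed
    also have "\<dots> \<le> e\<^sup>2 / 4" by (intro divide_left_mono) auto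
    also have "\<dots> = (e / 2)\<^sup>2" by (simp add: power_divide)
    finally show "(W.nrm (W.diff [(f, x)] [(f, y)]))\<^sup>2 \<le> (e / 2)\<^sup>2" .
  qed (use Cons.prems in simp)
  then have "W.nrm (W.diff ([(f, x)] @ v) ([(f, y)] @ v')) < e"
    using W.nrm_diff_add[OF in'(1) v in'(2,3)] v'(2) by simp
  then show ?case using p f y v'(1) by (intro exI[of _ "(f, y) # v'"]) auto
qed

definition mult_op :: "'n cpoly \<Rightarrow> ('n cpoly \<times> 'v) list \<Rightarrow> ('n cpoly \<times> 'v) list"
  where "mult_op g = map (apfst (\<lambda>f. f * g))"

lemma mult_op_form: "form w (mult_op g u) v = form w u (mult_op (star g) v)"
  by (simp add: form_def mult_op_def comp_def star_mult star_star mult_ac)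

lemma mult_op_form_self: "form 1 (mult_op g u) (mult_op g v) = form (g * star g) u v"
  by (simp add: form_def mult_op_def comp_def star_mult star_star mult_ac)

lemma mult_op_in: "v \<in> vectors \<Longrightarrow> mult_op (zvar j) v \<in> vectors" "v \<in> vectors \<Longrightarrow> mult_op (zbar j) v \<in> vectors"
  by (auto simp: mult_op_def mult_monomials_var)

lemma mult_op_commute: "mult_op f (mult_op g v) = mult_op g (mult_op f v)"
  by (auto simp: mult_op_def mult_ac)

text \<open>The squared norm of \<open>mult_op g v\<close> is the form with weight
  \<open>g * star g\<close>, which is \<open>zvar j * zbar j\<close> in both cases. Since
  \<open>R\<^sup>2 - zvar j * zbar j\<close> is a good weight, it is at most
  \<open>R\<^sup>2\<close> times the form with weight 1.\<close>

lemma mult_op_bound: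
  assumes v: "v \<in> vectors" and g: "g = zvar j \<or> g = zbar j"
  shows "W.nrm (mult_op g v) \<le> R * W.nrm v"
proof (rule power2_le_imp_le)
  have in': "mult_op g v \<in> vectors" using v g mult_op_in by blast
  have gg: "g * star g = zvar j * zbar j"
    using g by (auto simp: star_zvar star_zbar mult.commute)
  have diff: "form (w - w') v v = form w v v - form w' v v" for w w'
    by (simp add: form_def left_diff_distrib L_diff sum_list_subtractf)
  have "0 \<le> Re (form (1 * (const_poly (complex_of_real (R\<^sup>2)) - zvar j * zbar j)) v v)"
    using v by (intro form_nonneg_good good_mult_diff good_1 tempered_zvar_zbar) auto
  also have "form (1 * (const_poly (complex_of_real (R\<^sup>2)) - zvar j * zbar j)) v v =
      form (const_poly (complex_of_real (R\<^sup>2))) v v - form (zvar j * zbar j) v v"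
    by (simp add: diff)
  also have "form (const_poly (complex_of_real (R\<^sup>2))) v v = complex_of_real (R\<^sup>2) * form 1 v v"
    by (simp add: form_def L_const sum_list_const_mult del: of_real_power)
  finally have "Re (form (zvar j * zbar j) v v) \<le> R\<^sup>2 * Re (form 1 v v)" by simp
  then show "(W.nrm (mult_op g v))\<^sup>2 \<le> (R * W.nrm v)\<^sup>2"
    unfolding W.nrm_square[OF in'] power_mult_distrib W.nrm_square[OF v] mult_op_form_self gg .
  show "0 \<le> R * W.nrm v" using R_pos W.nrm_nonneg[OF v] by simp
qed

lemma form_add_vector:
  assumes "x \<in> hset E" "y \<in> hset E" "snd ` set u \<subseteq> hset E"
  shows "form w [(f, x + y)] u = form w [(f, x)] u + form w [(f, y)] u"
  using assms(3) by (induction u) (simp_all add: form_def L_add_left assms(1,2))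

text \<open>Two different lists have the same pairings, hence become the same point of the
  completion. This is why multiplication by \<open>zvar j\<close> extends
  \<open>T j\<close>.\<close>

lemma form_T:
  assumes "x \<in> hset E" "snd ` set u \<subseteq> hset E"
  shows "form 1 [(zvar j, x)] u = form 1 [(1, T j x)] u"
  using assms(2)
  by (induction u) (simp_all add: form_def assms(1) mult.commute[of "zvar j"] L_zvar)

theorem subnormal: "subnormal E T"
proof -
  have "\<exists>D\<subseteq>hset E. countable D \<and> (\<forall>x\<in>hset E. \<forall>e>0. \<exists>d\<in>D. hnorm E (x - d) < e)"
    using hilbert_space unfolding hilbert_space_def by - (elim conjE, assumption)
  then obtain D where D: "D \<subseteq> hset E" "countable D"
    "\<forall>x\<in>hset E. \<forall>e>0. \<exists>y\<in>D. hnorm E (x - y) < e" by blast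
  \<comment> \<open>Lists over a countable set, dense among \<open>vectors\<close> and stable under
    multiplication by the variables, so that index maps exist.\<close>
  define \<C> where "\<C> = lists (monomials \<times> D)"
  have "countable \<C>" unfolding \<C>_def using D(2) countable_monomials by (intro countable_lists countable_SIGMA)
  moreover have "\<C> \<noteq> {}" unfolding \<C>_def by blast
  ultimately obtain d :: "nat \<Rightarrow> ('n cpoly \<times> 'v) list" where d: "range d = \<C>"
    using range_from_nat_into by metis
  interpret C: dense_psd_form vectors append lscale "form 1" d
  proof
    show d_in: "d n \<in> vectors" for n
      using d D(1) unfolding \<C>_def by (fastforce simp: lists_eq_set)
    fix v e assume "v \<in> vectors" "0 < (e :: real)"
    then obtain v' where v': "set v' \<subseteq> monomials \<times> D" "W.nrm (W.diff v v') < e"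
      using W_dense[OF D(1,3)] by blast
    then have "v' \<in> range d" unfolding d \<C>_def by (auto simp: lists_eq_set)
    with v' show "\<exists>n. W.nrm (W.diff v (d n)) < e" by auto
  qed
  have "mult_op (zvar j) (d n) \<in> range d" "mult_op (zbar j) (d n) \<in> range d" for j n
  proof -
    have "d n \<in> \<C>" using d by auto
    then show "mult_op (zvar j) (d n) \<in> range d" "mult_op (zbar j) (d n) \<in> range d"
      unfolding d \<C>_def by (fastforce simp: lists_eq_set mult_op_def mult_monomials_var)+
  qed
  then have "\<forall>j n. \<exists>k. d k = mult_op (zvar j) (d n)" "\<forall>j n. \<exists>k. d k = mult_op (zbar j) (d n)"
    by (metis imageE)+
  then obtain \<sigma> \<tau> where \<tau>: "\<And>j n. d (\<tau> j n) = mult_op (zvar j) (d n)"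
    and \<sigma>: "\<And>j n. d (\<sigma> j n) = mult_op (zbar j) (d n)" by metis
  have pair: "adjoint_pair vectors append lscale (form 1) d (mult_op (zvar j)) (mult_op (zbar j)) R (\<sigma> j) (\<tau> j)" for j
  proof (unfold_locales, goal_cases)
    case (4 v) then show ?case by (rule mult_op_bound[where j = j]) simp
  next
    case (5 v) then show ?case by (rule mult_op_bound[where j = j]) simp
  qed (use mult_op_in in \<open>simp_all add: mult_op_form star_zvar \<sigma> \<tau>\<close>)
  define J where "J x = C.hat [(1, x)]" for x
  have in1: "[(1, x)] \<in> vectors" if "x \<in> hset E" for x using that one_monomials by simp
  have J_add: "J (x + y) = J x + J y" if "x \<in> hset E" "y \<in> hset E" for x y
  proof
    fix n
    have "snd ` set (d n) \<subseteq> hset E" using C.d_in[of n] by auto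
    then show "J (x + y) n = (J x + J y) n"
      using that by (simp add: J_def C.hat_def form_add_vector)
  qed
  have J_scl: "J (hscale E c x) = (\<lambda>n. c * J x n)" if "x \<in> hset E" for c x
    using C.hat_scl[OF in1[OF that], of c] by (simp add: J_def lscale_def)
  have J_T: "J x \<circ> \<sigma> j = J (T j x)" if x: "x \<in> hset E" for x j
  proof -
    interpret P: adjoint_pair vectors append lscale "form 1" d "mult_op (zvar j)" "mult_op (zbar j)" R "\<sigma> j" "\<tau> j"
      by (rule pair)
    have "J x \<circ> \<sigma> j = C.hat [(zvar j, x)]"
      using P.hat_N[OF in1[OF x]] by (simp add: J_def mult_op_def)
    also have "\<dots> = J (T j x)"
    proof
      fix n
      have "snd ` set (d n) \<subseteq> hset E" using C.d_in[of n] by auto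
      then show "C.hat [(zvar j, x)] n = J (T j x) n"
        unfolding J_def C.hat_def by (rule form_T[OF x])
    qed
    finally show ?thesis .
  qed
  show ?thesis
    unfolding subnormal_def
  proof (intro exI conjI allI ballI)
    show "hilbert_space C.completion" by (rule C.hilbert_space_completion)
    show "isometric_embedding E C.completion J"
      unfolding isometric_embedding_def linear_map_def
    proof (intro conjI ballI allI)
      show "J ` hset E \<subseteq> hset C.completion" using C.hat_in[OF in1] by (auto simp: J_def)
      fix x y assume "x \<in> hset E" "y \<in> hset E"
      then show "hinner C.completion (J x) (J y) = hinner E x y"
        using C.ip_hat[OF in1 in1, of x y] by (simp add: J_def form_def star_1 L_one)
    qed (simp_all add: J_add J_scl)
    show "normal_operator C.completion (\<lambda>\<phi>. \<phi> \<circ> \<sigma> j)" for j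
      by (rule adjoint_pair.normal_operator_N[OF pair]) (rule mult_op_commute)
    show "commuting C.completion (\<lambda>j \<phi>. \<phi> \<circ> \<sigma> j)"
      unfolding commuting_def
    proof (intro allI ballI)
      fix i j \<phi> assume "\<phi> \<in> hset C.completion"
      then obtain v where v: "C.rep \<phi> v" by auto
      show "\<phi> \<circ> \<sigma> j \<circ> \<sigma> i = \<phi> \<circ> \<sigma> i \<circ> \<sigma> j"
      proof
        fix n
        have "d (\<sigma> j (\<sigma> i n)) = d (\<sigma> i (\<sigma> j n))" unfolding \<sigma> by (rule mult_op_commute)
        then show "(\<phi> \<circ> \<sigma> j \<circ> \<sigma> i) n = (\<phi> \<circ> \<sigma> i \<circ> \<sigma> j) n"
          unfolding o_apply by (rule C.rep_cong[OF v])
      qed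
    qed
    show "(\<lambda>\<phi>. \<phi> \<circ> \<sigma> j) ` J ` hset E \<subseteq> J ` hset E" for j
      using J_T by auto
    show "J x \<circ> \<sigma> j = J (T j x)" if "x \<in> hset E" for j x
      using that by (rule J_T)
  qed
qed

end

section \<open>From the Quillen property to the one-vector inequality\<close>

theorem corollary6p8:
  fixes M :: "'n::finite cpoly set"
  assumes "hermitian_module M"
    and "quillen_property M"
  shows "subnormality_property TYPE('v::ab_group_add) M"
  unfolding subnormality_property_def
proof (intro allI impI)
  fix E :: "'v hilb" and T :: "'n \<Rightarrow> 'v \<Rightarrow> 'v"
  assume *: "hilbert_space E \<and> (\<forall>j. bounded_operator E (T j)) \<and> commuting E T \<and>
      (\<forall>p\<in>M. positive_operator E (hereditary E T p))"
  interpret hilbert E using * by unfold_locales blast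
  have "\<forall>j. \<exists>K. \<forall>x\<in>hset E. nrm (T j x) \<le> K * nrm x"
    using * by (simp add: bounded_operator_def nrm_eq)
  then obtain K where K: "\<And>j x. x \<in> hset E \<Longrightarrow> nrm (T j x) \<le> K j * nrm x" by metis
  \<comment> \<open>A common bound for all \<open>T j\<close>, made strictly positive by the summand
    1.\<close>
  define R where "R = 1 + (\<Sum>j\<in>UNIV. \<bar>K j\<bar>)"
  interpret bounded_commuting_tuple E T R
  proof
    show "R > 0" by (simp add: R_def add_pos_nonneg sum_nonneg)
    fix x j assume x: "x \<in> hset E"
    have "\<bar>K j\<bar> \<le> (\<Sum>j\<in>UNIV. \<bar>K j\<bar>)" by (rule member_le_sum) auto
    then have "K j \<le> R" by (simp add: R_def)
    then have "K j * nrm x \<le> R * nrm x" using x by (intro mult_right_mono nrm_nonneg)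
    then show "nrm (T j x) \<le> R * nrm x" using K[OF x, of j] by simp
  qed (use * in auto)
  interpret positive_tuple E T R
  proof
    fix x q assume x: "x \<in> hset E"
    have *: "0 \<le> Re (L x x (q * star q)) + e * Re (hinner E x x)" if e: "e > 0" for e
    proof -
      \<comment> \<open>The square is nonnegative at every point, and \<open>e\<close> makes it
        strictly positive as (Q) requires.\<close>
      define f where "f = q * star q + const_poly (complex_of_real e)"
      have "f \<in> real_polys"
        by (simp add: f_def real_polys_def star_add star_mult star_star star_const_poly mult.commute)
      moreover have "0 < value_at f a" for a
        using e by (simp add: value_at_def f_def evaluate_add evaluate_mult evaluate_star
            evaluate_const_poly add_nonneg_pos)
      ultimately have "f \<in> M" using assms(2) by (simp add: quillen_property_def)
      then have "hinner E (hereditary E T f x) x \<in> \<real>\<^sub>\<ge>\<^sub>0"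
        using * x by (simp add: positive_operator_def)
      then have "0 \<le> Re (L x x f)" unfolding hereditary_inner[OF x x]
        by (simp add: complex_nonneg_Reals_iff)
      moreover have "L x x f = L x x (q * star q) + complex_of_real e * hinner E x x"
        using L_const[of x x "complex_of_real e" 1] by (simp add: f_def L_add L_one)
      ultimately show ?thesis by simp
    qed
    show "0 \<le> Re (L x x (q * star q))"
    proof (rule field_le_epsilon)
      fix e :: real assume e: "e > 0"
      \<comment> \<open>The summand 1 avoids division by zero for \<open>x = 0\<close>.\<close>
      define r where "r = Re (hinner E x x) + 1"
      have r: "r > 0" using form_nonneg[OF x] by (simp add: r_def)
      have "e / r * Re (hinner E x x) \<le> e / r * r"
        using e r by (intro mult_left_mono) (auto simp: r_def)
      then show "0 \<le> Re (L x x (q * star q)) + e" using *[of "e / r"] e r by simp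
    qed
  qed
  show "subnormal E T" by (rule subnormal)
qed

end
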